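(* Let $n=2m+1$ with $m\in\mathbb N$. Every matrix function $F(x)$ of class $\mathfrak F_n$ is associated with some differential expression $\ell_n(y)$ whose coefficients $\mathcal T=(\tau_\nu)_{\nu=0}^{n-1}$ belong to $\mathfrak T_n$. In other words, $$\mathfrak F_n=\bigcup_{\mathcal T\in\mathfrak T_n}\mathfrak F(\mathcal T).$$
   Context: All functions are complex-valued. $n=2m+1$, $m\in\mathbb N$. $\mathfrak D=C_0^\infty(0,1)$, $\mathfrak D'$ is the space of distributions on $(0,1)$. For $i\ge 0$, $W_1^{-i}[0,1]$ is the set of distributions $\sigma^{(i)}$ with $\sigma\in L_1[0,1]$ ($W_1^0=L_1$). Singularity orders: $i_{2k+j}:=m-k-j$ for $k\ge 0$, $j\in\{0,1\}$. Coefficient space: $\mathfrak T_n:=\{\mathcal T=(\tau_\nu)_{\nu=0}^{n-1}:\tau_\nu\in W_1^{-i_\nu}[0,1],\ \nu=0,\dots,n-1\}$. Differential expression with coefficients $\mathcal T$: $$\ell_n(y)=y^{(n)}+\sum_{k=0}^{m}(-1)^k(\tau_{2k}y^{(k)})^{(k)}+\sum_{k=0}^{m-1}(-1)^{k+1}\Bigl((\tau_{2k+1}y^{(k)})^{(k+1)}+(\tau_{2k+1}y^{(k+1)})^{(k)}\Bigr),$$ understood in $\mathfrak D'$; here the product of $\tau=\sigma^{(i)}$, $\sigma\in L_1[0,1]$, and $g\in W_1^{i+1}[0,1]$ is the distribution $(\tau g,z)=(-1)^i\int_0^1\sigma\,(gz)^{(i)}\,dx$, $z\in\mathfrak D$.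 $\mathfrak F_n$ is the set of $n\times n$ matrix functions $F=[f_{k,j}]_{k,j=1}^n$ on $[0,1]$ such that $f_{k,j}\in L_1[0,1]$ for $k=m+1,\dots,2m+1$, $j=1,\dots,m+1$, and $f_{k,j}=0$ whenever $k<m+1$ or $j>m+1$. For $F\in\mathfrak F_n$ the quasi-derivatives are $y^{[0]}:=y$, $y^{[k]}:=(y^{[k-1]})'-\sum_{j=1}^k f_{k,j}y^{[j-1]}$, $k=1,\dots,n$, and $\mathcal D_F:=\{y: y^{[k]}\in W_1^1[0,1],\ k=0,\dots,n-1\}$ (so that $\mathcal D_F\subset W_1^{m+1}[0,1]$). $F\in\mathfrak F_n$ is called associated with $\ell_n(y)$ if $\ell_n(y)=y^{[n]}$ for every $y\in\mathcal D_F$ (quasi-derivatives taken with respect to $F$). $\mathfrak F(\mathcal T)\subset\mathfrak F_n$ denotes the set of all matrices associated with the expression $\ell_n$ having coefficients $\mathcal T$. *)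

theory Defs
  imports "HOL-Analysis.Analysis"
begin

section \<open>Test functions and distributions on the open unit interval\<close>

definition vderiv :: "(real \<Rightarrow> complex) \<Rightarrow> real \<Rightarrow> complex" where
  "vderiv f = (\<lambda>x. vector_derivative f (at x))"

text \<open>A test function on \<open>(0,1)\<close> is identified with its extension by zero to the real line.
  The support is a closed subset of a bounded interval, hence compact.\<close>

definition test_functions :: "(real \<Rightarrow> complex) set" where
  "test_functions =
     {z. (\<forall>i x. (vderiv ^^ i) z differentiable (at x)) \<and> closure {x. z x \<noteq> 0} \<subseteq> {0<..<1}}"

type_synonym functional = "(real \<Rightarrow> complex) \<Rightarrow> complex"

text \<open>Only the values on test functions matter: two functionals are the same distribution
  iff they agree on \<open>test_functions\<close>.\<close>

definition distributions :: "functional set" where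
  "distributions =
     {T. (\<forall>z\<in>test_functions. \<forall>w\<in>test_functions. T (\<lambda>x. z x + w x) = T z + T w) \<and>
         (\<forall>c. \<forall>z\<in>test_functions. T (\<lambda>x. c * z x) = c * T z) \<and>
         (\<forall>a b. 0 < a \<and> a < b \<and> b < 1 \<longrightarrow>
            (\<exists>C N. \<forall>z\<in>test_functions. (\<forall>x. x \<notin> {a..b} \<longrightarrow> z x = 0) \<longrightarrow>
               norm (T z) \<le> C * (\<Sum>j\<le>N. SUP x\<in>{a..b}. norm ((vderiv ^^ j) z x))))}"

definition dist_eq :: "functional \<Rightarrow> functional \<Rightarrow> bool" where
  "dist_eq S T \<longleftrightarrow> (\<forall>z\<in>test_functions. S z = T z)"

definition regular :: "(real \<Rightarrow> complex) \<Rightarrow> functional" where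
  "regular \<sigma> = (\<lambda>z. integral {0..1} (\<lambda>x. \<sigma> x * z x))"

definition dderiv :: "functional \<Rightarrow> functional" where
  "dderiv T = (\<lambda>z. - T (vderiv z))"

section \<open>Sobolev spaces on the closed unit interval\<close>

definition L1 :: "(real \<Rightarrow> complex) set" where
  "L1 = {f. f absolutely_integrable_on {0..1}}"

text \<open>\<open>has_L1_deriv u g\<close>: \<open>u\<close> is absolutely continuous on \<open>[0,1]\<close> with
  \<open>u' = g\<close> almost everywhere.\<close>

definition has_L1_deriv :: "(real \<Rightarrow> complex) \<Rightarrow> (real \<Rightarrow> complex) \<Rightarrow> bool" where
  "has_L1_deriv u g \<longleftrightarrow> g \<in> L1 \<and> (\<forall>x\<in>{0..1}. u x = u 0 + integral {0..x} g)"

text \<open>\<open>W k\<close> is the space \<open>W\<^sub>1\<^sup>k[0,1]\<close>; for \<open>k \<ge> 1\<close> its elements are represented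
  by their absolutely continuous representatives.\<close>

primrec W :: "nat \<Rightarrow> (real \<Rightarrow> complex) set" where
  "W 0 = L1"
| "W (Suc k) = {u. \<exists>g\<in>W k. has_L1_deriv u g}"

definition W_neg :: "nat \<Rightarrow> functional set" where
  "W_neg i = {\<tau>\<in>distributions. \<exists>\<sigma>\<in>L1. dist_eq \<tau> ((dderiv ^^ i) (regular \<sigma>))}"

text \<open>The product of \<open>\<tau> = \<sigma>\<^sup>(\<^sup>i\<^sup>)\<close> in \<open>W_neg i\<close> with \<open>g\<close> in \<open>W (i + 1)\<close>.
  The primitive \<open>\<sigma>\<close> is determined up to a polynomial of degree less than \<open>i\<close>, which does not
  affect the product.  Since \<open>g\<close> is \<open>i\<close> times continuously differentiable, the derivative of
  \<open>g z\<close> is a classical one.\<close>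

definition dist_mult :: "nat \<Rightarrow> functional \<Rightarrow> (real \<Rightarrow> complex) \<Rightarrow> functional" where
  "dist_mult i \<tau> g =
     (let \<sigma> = (SOME \<sigma>. \<sigma> \<in> L1 \<and> dist_eq \<tau> ((dderiv ^^ i) (regular \<sigma>)))
      in (\<lambda>z. (-1) ^ i * integral {0..1} (\<lambda>x. \<sigma> x * (vderiv ^^ i) (\<lambda>t. g t * z t) x)))"

section \<open>Differential expressions of order \<open>2 m + 1\<close>\<close>

text \<open>For \<open>\<nu> = 2 k + j \<le> 2 m\<close> with \<open>j \<in> {0,1}\<close> the value is \<open>m - k - j\<close>, and the
  subtraction is not truncated.\<close>

definition sing_order :: "nat \<Rightarrow> nat \<Rightarrow> nat" where
  "sing_order m \<nu> = m - \<nu> div 2 - \<nu> mod 2"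

definition coeff_space :: "nat \<Rightarrow> (nat \<Rightarrow> functional) set" where
  "coeff_space m = {\<tau>. \<forall>\<nu><2 * m + 1. \<tau> \<nu> \<in> W_neg (sing_order m \<nu>)}"

definition ell :: "nat \<Rightarrow> (nat \<Rightarrow> functional) \<Rightarrow> (real \<Rightarrow> complex) \<Rightarrow> functional" where
  "ell m \<tau> y = (\<lambda>z.
     (let mul = (\<lambda>\<nu> g. dist_mult (sing_order m \<nu>) (\<tau> \<nu>) g);
          D = (\<lambda>k T. (dderiv ^^ k) T);
          y' = (\<lambda>k. (vderiv ^^ k) y)
      in D (2 * m + 1) (regular y) z
         + (\<Sum>k\<le>m. (-1) ^ k * D k (mul (2 * k) (y' k)) z)
         + (\<Sum>k<m. (-1) ^ (k + 1) *
               (D (k + 1) (mul (2 * k + 1) (y' k)) z + D k (mul (2 * k + 1) (y' (k + 1))) z))))"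

section \<open>Matrix functions and quasi-derivatives\<close>

text \<open>Matrices are indexed from 1; entries outside \<open>{1..2 m + 1}\<close> are never used.\<close>

definition matrix_class :: "nat \<Rightarrow> (nat \<Rightarrow> nat \<Rightarrow> real \<Rightarrow> complex) set" where
  "matrix_class m =
     {F. (\<forall>k\<in>{m + 1..2 * m + 1}. \<forall>j\<in>{1..m + 1}. F k j \<in> L1) \<and>
         (\<forall>k\<in>{1..2 * m + 1}. \<forall>j\<in>{1..2 * m + 1}. k < m + 1 \<or> j > m + 1 \<longrightarrow>
            (\<forall>x\<in>{0..1}. F k j x = 0))}"

text \<open>\<open>quasi_derivs m F y q\<close>: the functions \<open>q 0, \<dots>, q (2 m + 1)\<close> are the quasi-derivatives
  of \<open>y\<close>.  This determines \<open>q k\<close> on \<open>[0,1]\<close> for \<open>k \<le> 2 m\<close> and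
  \<open>q (2 m + 1)\<close> almost everywhere.\<close>

definition quasi_derivs ::
  "nat \<Rightarrow> (nat \<Rightarrow> nat \<Rightarrow> real \<Rightarrow> complex) \<Rightarrow> (real \<Rightarrow> complex) \<Rightarrow> (nat \<Rightarrow> real \<Rightarrow> complex) \<Rightarrow> bool" where
  "quasi_derivs m F y q \<longleftrightarrow>
     (\<forall>x\<in>{0..1}. q 0 x = y x) \<and>
     (\<forall>k\<in>{1..2 * m + 1}. \<exists>g. has_L1_deriv (q (k - 1)) g \<and>
        (AE x in lebesgue_on {0..1}. q k x = g x - (\<Sum>j=1..k. F k j x * q (j - 1) x)))"

definition quasi_domain :: "nat \<Rightarrow> (nat \<Rightarrow> nat \<Rightarrow> real \<Rightarrow> complex) \<Rightarrow> (real \<Rightarrow> complex) set" where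
  "quasi_domain m F = {y. \<exists>q. quasi_derivs m F y q \<and> (\<forall>k\<le>2 * m. q k \<in> W 1)}"

definition associated :: "nat \<Rightarrow> (nat \<Rightarrow> functional) \<Rightarrow> (nat \<Rightarrow> nat \<Rightarrow> real \<Rightarrow> complex) \<Rightarrow> bool" where
  "associated m \<tau> F \<longleftrightarrow>
     (\<forall>y\<in>quasi_domain m F. \<forall>q. quasi_derivs m F y q \<longrightarrow>
        dist_eq (ell m \<tau> y) (regular (q (2 * m + 1))))"

definition associated_matrices ::
  "nat \<Rightarrow> (nat \<Rightarrow> functional) \<Rightarrow> (nat \<Rightarrow> nat \<Rightarrow> real \<Rightarrow> complex) set" where
  "associated_matrices m \<tau> = {F\<in>matrix_class m. associated m \<tau> F}"

end

theory Submission
  imports Defs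
begin

text \<open>On test functions, \<open>y\<^sup>[\<^sup>n\<^sup>]\<close> equals \<open>y\<^sup>(\<^sup>n\<^sup>)\<close> up to functionals
  \<open>\<integral> c y\<^sup>(\<^sup>a\<^sup>) z\<^sup>(\<^sup>b\<^sup>)\<close> with \<open>a, b \<le> m\<close> and integrable \<open>c\<close>. Replacing \<open>c\<close> by a primitive and
  integrating by parts raises \<open>a + b\<close> as long as \<open>a, b < m\<close>. On each level \<open>a + b = m + k\<close> this leaves
  the pairs \<open>(m, k)\<close> and \<open>(k, m)\<close>, and they are absorbed by the terms with \<open>\<tau>\<^sub>2\<^sub>k\<close> and
  \<open>\<tau>\<^sub>2\<^sub>k\<^sub>+\<^sub>1\<close>: their Leibniz expansions are homogeneous of the same level, and up to interior
  pairs they are the sum and the difference of the two pairs.\<close>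

section \<open>Integration by parts with an integrable derivative\<close>

text \<open>The unknowns match in number: each of the levels \<open>m, ..., 2 * m - 1\<close>
  carries two boundary pairs and the top level only \<open>(m, m)\<close>, which gives
  \<open>2 * m + 1\<close> pairs for as many coefficients. Below the top, the two coefficient terms
  of a level act on its boundary pairs, up to sign, by the matrix with rows \<open>1, 1\<close> and
  \<open>1, -1\<close>; its inverse is the origin of the factors \<open>1/2\<close>. The interior
  pairs that a Leibniz expansion leaves behind have both orders below \<open>m\<close>, so one more
  integration by parts pushes them to the next level, and the process ends at \<open>(m, m)\<close>.
  Two obstacles shape the rest. The entries of \<open>F\<close> are merely integrable, so
  \<open>y\<close> offers continuous classical derivatives only up to order \<open>m\<close>, and no
  step may ask for more. The product with a distribution is defined through an arbitrarily chosen
  primitive, so independence of this choice has to be proved for factors of finite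
  smoothness.\<close>

lemma L1_integrable: "c \<in> L1 \<Longrightarrow> c integrable_on {0..1}"
  by (simp add: L1_def set_lebesgue_integral_eq_integral(1))

lemma L1_continuous: "continuous_on {0..1} f \<Longrightarrow> f \<in> L1"
  by (simp add: L1_def absolutely_integrable_continuous_real)

lemma L1_mult_continuous:
  assumes "c \<in> L1" "continuous_on {0..1} f"
  shows "(\<lambda>x. c x * f x) \<in> L1"
proof -
  have "(\<lambda>x. f x * c x) absolutely_integrable_on {0..1}"
  proof (rule absolutely_integrable_bounded_measurable_product[where h = "(*)"])
    show "bilinear ((*) :: complex \<Rightarrow> complex \<Rightarrow> complex)"
      by (simp add: bilinear_times)
    show "f \<in> borel_measurable (lebesgue_on {0..1})"
      using assms(2) by (intro continuous_imp_measurable_on_sets_lebesgue) auto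
    show "bounded (f ` {0..1})"
      using assms(2) by (simp add: compact_continuous_image compact_imp_bounded)
  qed (use assms(1) in \<open>auto simp: L1_def\<close>)
  then show ?thesis
    by (simp add: L1_def mult.commute)
qed

lemma L1_add: "c \<in> L1 \<Longrightarrow> d \<in> L1 \<Longrightarrow> (\<lambda>x. c x + d x) \<in> L1"
  by (simp add: L1_def set_integral_add(1))

lemma L1_cmult: "c \<in> L1 \<Longrightarrow> (\<lambda>x. a * c x) \<in> L1"
  by (simp add: L1_def)

lemma L1_diff: "c \<in> L1 \<Longrightarrow> d \<in> L1 \<Longrightarrow> (\<lambda>x. c x - d x) \<in> L1"
  by (simp add: L1_def set_integral_diff(1))

lemma L1_integral_continuous:
  "c \<in> L1 \<Longrightarrow> continuous_on {0..1} (\<lambda>x. integral {0..x} c)"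
  by (intro indefinite_integral_continuous_1 L1_integrable)

lemma has_L1_deriv_continuous:
  assumes "has_L1_deriv u g"
  shows "continuous_on {0..1} u"
proof -
  have cont: "continuous_on {0..1} (\<lambda>x. u 0 + integral {0..x} g)"
    using assms by (intro continuous_intros L1_integral_continuous) (simp add: has_L1_deriv_def)
  have eq: "u x = u 0 + integral {0..x} g" if "x \<in> {0..1}" for x
    using assms that unfolding has_L1_deriv_def by blast
  show ?thesis
    by (rule continuous_on_eq[OF cont]) (rule eq[symmetric])
qed

text \<open>The difference quotients of the defect of the integration by parts formula tend to \<open>0\<close> because
  \<open>A\<close> is continuous; no differentiation theorem for the primitive \<open>C\<close> is needed.\<close>

lemma product_primitive_increment_bound:
  fixes c g g' :: "real \<Rightarrow> complex"
  defines "C \<equiv> \<lambda>x. integral {0..x} c"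
  defines "A \<equiv> \<lambda>x. integral {0..x} (\<lambda>t. norm (c t))"
  assumes c: "c \<in> L1"
    and g: "\<And>x. x \<in> {0..1} \<Longrightarrow> (g has_vector_derivative g' x) (at x within {0..1})"
    and g': "continuous_on {0..1} g'"
    and K: "\<And>x. x \<in> {0..1} \<Longrightarrow> norm (g' x) \<le> K"
    and xy: "0 \<le> x" "x \<le> y" "y \<le> 1"
  shows "norm ((integral {0..y} (\<lambda>t. c t * g t + C t * g' t) - C y * g y)
      - (integral {0..x} (\<lambda>t. c t * g t + C t * g' t) - C x * g x)) \<le> 2 * K * (y - x) * (A y - A x)"
proof -
  have contg: "continuous_on {0..1} g"
    using g by (rule continuous_on_vector_derivative)
  have contC: "continuous_on {0..1} C"
    unfolding C_def by (rule L1_integral_continuous[OF c])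
  have sub: "{x..y} \<subseteq> {0..1}" using xy by auto
  have cint: "c integrable_on {0..1}" by (rule L1_integrable[OF c])
  have nint: "(\<lambda>t. norm (c t)) integrable_on {0..1}"
    using c by (simp add: L1_def absolutely_integrable_on_def)
  have sub01: "f integrable_on {a..b}" if "f integrable_on {0..1}" "0 \<le> a" "b \<le> 1" for a b and f :: "real \<Rightarrow> complex"
    using that by (meson atLeastatMost_subset_iff integrable_on_subinterval)
  have nsub: "(\<lambda>t. norm (c t)) integrable_on {a..b}" if "0 \<le> a" "b \<le> 1" for a b
    using nint that by (meson atLeastatMost_subset_iff integrable_on_subinterval)
  note ci = sub01[OF cint]
  have cmb: "integral {0..b} f - integral {0..a} f = integral {a..b} f"
    if "f integrable_on {0..1}" "0 \<le> a" "a \<le> b" "b \<le> 1" for a b and f :: "real \<Rightarrow> complex"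
    using Henstock_Kurzweil_Integration.integral_combine[of 0 a b f] that sub01[of f 0 b] by (simp add: algebra_simps)
  have ncmb: "A b - A a = integral {a..b} (\<lambda>t. norm (c t))"
    if "0 \<le> a" "a \<le> b" "b \<le> 1" for a b
    using Henstock_Kurzweil_Integration.integral_combine[of 0 a b "\<lambda>t. norm (c t)"] that nsub[of 0 b] by (simp add: algebra_simps A_def)
  have Cdiff: "norm (C b - C a) \<le> A b - A a" if "0 \<le> a" "a \<le> b" "b \<le> 1" for a b
    using that cmb[OF cint, of a b] ncmb[of a b]
    by (simp add: C_def) (intro integral_norm_bound_integral ci nsub; simp)
  have Amono: "A a \<le> A b" if "0 \<le> a" "a \<le> b" "b \<le> 1" for a b
    using Cdiff[OF that] norm_ge_zero[of "C b - C a"] by linarith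
  have cg: "(\<lambda>t. c t * g t) integrable_on {0..1}"
    by (intro L1_integrable L1_mult_continuous c contg)
  have Cg': "(\<lambda>t. C t * g' t) integrable_on {0..1}"
    by (intro integrable_continuous_real continuous_intros contC g')
  have g'i: "g' integrable_on {0..1}" by (intro integrable_continuous_real g')
  have gFTC: "integral {a..b} g' = g b - g a" if "0 \<le> a" "a \<le> b" "b \<le> 1" for a b
  proof (intro integral_unique fundamental_theorem_of_calculus that)
    fix t assume "t \<in> {a..b}"
    then show "(g has_vector_derivative g' t) (at t within {a..b})"
      using that by (intro has_vector_derivative_within_subset[OF g]) auto
  qed
  have i1: "(\<lambda>t. c t * (g t - g x)) integrable_on {x..y}"
    by (rule sub01[OF L1_integrable]) (use xy in \<open>auto intro!: L1_mult_continuous c continuous_intros contg\<close>)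
  have i2: "(\<lambda>t. (C t - C y) * g' t) integrable_on {x..y}"
    by (rule sub01[OF integrable_continuous_real]) (use xy in \<open>auto intro!: continuous_intros contC g'\<close>)
  \<comment> \<open>The increment of \<open>C * g\<close> is split as
    \<open>(C y - C x) * g x + C y * (g y - g x)\<close>, so that \<open>g\<close> is compared with
    its value at the left end and \<open>C\<close> with its value at the right end. Both remaining
    integrands are then products with a small factor, and each contributes at most
    \<open>K * (y - x) * (A y - A x)\<close>.\<close>
  have "(integral {0..y} (\<lambda>t. c t * g t + C t * g' t) - C y * g y)
      - (integral {0..x} (\<lambda>t. c t * g t + C t * g' t) - C x * g x)
      = integral {x..y} (\<lambda>t. c t * g t + C t * g' t) - (C y - C x) * g x - C y * (g y - g x)"
    using cmb[OF integrable_add[OF cg Cg'], of x y] xy by (simp add: algebra_simps)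
  also have "\<dots> = integral {x..y} (\<lambda>t. c t * (g t - g x)) + integral {x..y} (\<lambda>t. (C t - C y) * g' t)"
  proof -
    have "integral {x..y} (\<lambda>t. c t * g t + C t * g' t)
        = integral {x..y} (\<lambda>t. c t * g t) + integral {x..y} (\<lambda>t. C t * g' t)"
      using xy by (intro integral_add sub01[OF cg] sub01[OF Cg']) auto
    moreover have "integral {x..y} (\<lambda>t. c t * (g t - g x)) = integral {x..y} (\<lambda>t. c t * g t) - (C y - C x) * g x"
    proof -
      have "integral {x..y} (\<lambda>t. c t * (g t - g x)) = integral {x..y} (\<lambda>t. c t * g t - c t * g x)"
        by (simp add: algebra_simps)
      also have "\<dots> = integral {x..y} (\<lambda>t. c t * g t) - integral {x..y} (\<lambda>t. c t * g x)"
        using xy by (intro integral_diff sub01[OF cg] integrable_on_mult_left ci) auto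
      also have "integral {x..y} (\<lambda>t. c t * g x) = (C y - C x) * g x"
        using cmb[OF cint, of x y] xy by (simp add: C_def)
      finally show ?thesis .
    qed
    moreover have "integral {x..y} (\<lambda>t. (C t - C y) * g' t) = integral {x..y} (\<lambda>t. C t * g' t) - C y * (g y - g x)"
    proof -
      have "integral {x..y} (\<lambda>t. (C t - C y) * g' t) = integral {x..y} (\<lambda>t. C t * g' t - C y * g' t)"
        by (simp add: algebra_simps)
      also have "\<dots> = integral {x..y} (\<lambda>t. C t * g' t) - integral {x..y} (\<lambda>t. C y * g' t)"
        using xy by (intro integral_diff sub01[OF Cg'] integrable_on_mult_right sub01[OF g'i]) auto
      also have "integral {x..y} (\<lambda>t. C y * g' t) = C y * (g y - g x)"
        using gFTC[of x y] xy by simp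
      finally show ?thesis .
    qed
    ultimately show ?thesis by simp
  qed
  also have "norm \<dots> \<le> norm (integral {x..y} (\<lambda>t. c t * (g t - g x))) + norm (integral {x..y} (\<lambda>t. (C t - C y) * g' t))"
    by (rule norm_triangle_ineq)
  also have "\<dots> \<le> integral {x..y} (\<lambda>t. norm (c t) * (K * (y - x))) + integral {x..y} (\<lambda>t. (A y - A x) * K)"
  proof (intro add_mono integral_norm_bound_integral i1 i2)
    fix t assume t: "t \<in> {x..y}"
    have K0: "0 \<le> K" using K[of 0] norm_ge_zero[of "g' 0"] by (simp del: norm_ge_zero)
    have "norm (g t - g x) \<le> K * (t - x)"
    proof -
      have "norm (integral {x..t} g') \<le> integral {x..t} (\<lambda>_. K)"
        using t xy by (intro integral_norm_bound_integral sub01[OF g'i]) (auto intro: K)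
      then show ?thesis using gFTC[of x t] t xy by (simp add: mult.commute)
    qed
    also have "\<dots> \<le> K * (y - x)" using t K0 by (intro mult_left_mono) auto
    finally show "norm (c t * (g t - g x)) \<le> norm (c t) * (K * (y - x))"
      by (simp add: norm_mult mult_left_mono)
    have "norm (C t - C y) \<le> A y - A t" using Cdiff[of t y] t xy by (simp add: norm_minus_commute)
    also have "\<dots> \<le> A y - A x" using Amono[of x t] t xy by simp
    finally show "norm ((C t - C y) * g' t) \<le> (A y - A x) * K"
      using K[of t] t xy by (auto simp: norm_mult intro!: mult_mono order_trans[OF norm_ge_zero])
  qed (use xy in \<open>auto intro!: integrable_on_mult_left nsub\<close>)
  also have "integral {x..y} (\<lambda>t. norm (c t) * (K * (y - x))) = (A y - A x) * (K * (y - x))"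
    using ncmb[of x y] xy by simp
  also have "integral {x..y} (\<lambda>t. (A y - A x) * K) = (A y - A x) * K * (y - x)"
    using xy by (simp add: mult.commute)
  finally show ?thesis by (simp add: algebra_simps)
qed

text \<open>The defect \<open>H\<close> has derivative zero on the whole closed interval and is
  therefore constant; since \<open>g\<close> vanishes at both ends, \<open>H 1 = H 0\<close> is the
  formula for the primitive \<open>C\<close>. Passing from \<open>C\<close> to \<open>Q\<close> adds
  the constant \<open>Q 0\<close>, which is harmless because the integral of \<open>g'\<close> is
  zero.\<close>

lemma integral_by_parts_L1:
  assumes Q: "has_L1_deriv Q c"
    and g: "\<And>x. x \<in> {0..1} \<Longrightarrow> (g has_vector_derivative g' x) (at x within {0..1})"
    and g': "continuous_on {0..1} g'"
    and g0: "g 0 = 0" and g1: "g 1 = 0"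
  shows "integral {0..1} (\<lambda>x. c x * g x) = - integral {0..1} (\<lambda>x. Q x * g' x)"
proof -
  define C where "C = (\<lambda>x. integral {0..x} c)"
  define A where "A = (\<lambda>x. integral {0..x} (\<lambda>t. norm (c t)))"
  define H where "H = (\<lambda>x. integral {0..x} (\<lambda>t. c t * g t + C t * g' t) - C x * g x)"
  have c: "c \<in> L1" and QC: "\<And>x. x \<in> {0..1} \<Longrightarrow> Q x = Q 0 + C x"
    using Q unfolding has_L1_deriv_def C_def by blast+
  have contg: "continuous_on {0..1} g"
    using g by (rule continuous_on_vector_derivative)
  have contC: "continuous_on {0..1} C"
    unfolding C_def by (rule L1_integral_continuous[OF c])
  have contA: "continuous_on {0..1} A"
    unfolding A_def using c
    by (intro indefinite_integral_continuous_1) (simp add: L1_def absolutely_integrable_on_def)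
  obtain K where K: "\<And>x. x \<in> {0..1} \<Longrightarrow> norm (g' x) \<le> K"
    using compact_imp_bounded[OF compact_continuous_image[OF g' compact_Icc]]
    unfolding bounded_iff by blast
  have bound: "norm (H y - H x) \<le> 2 * K * \<bar>y - x\<bar> * \<bar>A y - A x\<bar>"
    if "x \<in> {0..1}" "y \<in> {0..1}" for x y
  proof -
    have *: "norm (H v - H u) \<le> 2 * K * (v - u) * (A v - A u)" if "0 \<le> u" "u \<le> v" "v \<le> 1" for u v
      unfolding H_def C_def A_def by (rule product_primitive_increment_bound[OF c g g' K that])
    have K0: "0 \<le> K" using K[of 0] norm_ge_zero[of "g' 0"] by (simp del: norm_ge_zero)
    have **: "2 * K * (v - u) * (A v - A u) \<le> 2 * K * \<bar>v - u\<bar> * \<bar>A v - A u\<bar>" if "u \<le> v" for u v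
      using that K0 by (simp add: mult_left_mono)
    show ?thesis
    proof (cases "x \<le> y")
      case True
      then show ?thesis using *[of x y] **[of x y] that by auto
    next
      case False
      then show ?thesis using *[of y x] **[of y x] that
        by (auto simp: norm_minus_commute abs_minus_commute)
    qed
  qed
  have "(H has_vector_derivative 0) (at x within {0..1})" if x: "x \<in> {0..1}" for x
  proof -
    have "((\<lambda>y. 2 * K * \<bar>A y - A x\<bar>) \<longlongrightarrow> 2 * K * \<bar>A x - A x\<bar>) (at x within {0..1})"
      using contA x by (intro tendsto_intros) (simp add: continuous_on_def)
    then have lim: "((\<lambda>y. 2 * K * \<bar>A y - A x\<bar>) \<longlongrightarrow> 0) (at x within {0..1})" by simp
    have "((\<lambda>y. (H y - H x - (y - x) *\<^sub>R 0) /\<^sub>R norm (y - x)) \<longlongrightarrow> 0) (at x within {0..1})"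
    proof (rule Lim_null_comparison[OF _ lim])
      show "\<forall>\<^sub>F y in at x within {0..1}. norm ((H y - H x - (y - x) *\<^sub>R 0) /\<^sub>R norm (y - x)) \<le> 2 * K * \<bar>A y - A x\<bar>"
        unfolding eventually_at_filter
      proof (intro always_eventually allI impI)
        fix y assume "y \<noteq> x" "y \<in> {0..1}"
        then show "norm ((H y - H x - (y - x) *\<^sub>R 0) /\<^sub>R norm (y - x)) \<le> 2 * K * \<bar>A y - A x\<bar>"
          using bound[OF x, of y] by (simp add: divide_simps mult_ac)
      qed
    qed
    then show ?thesis
      unfolding has_vector_derivative_def has_derivative_within
      by (simp add: bounded_linear_zero divide_inverse_commute scaleR_conv_of_real)
  qed
  then have "H 1 = H 0"
    using has_vector_derivative_zero_constant[of "{0..1}" H] by (metis convex_real_interval(5) atLeastAtMost_iff order_refl zero_le_one)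
  then have "integral {0..1} (\<lambda>t. c t * g t + C t * g' t) = 0"
    by (simp add: H_def g0 g1)
  moreover have "integral {0..1} (\<lambda>t. c t * g t + C t * g' t) = integral {0..1} (\<lambda>t. c t * g t) + integral {0..1} (\<lambda>t. C t * g' t)"
    by (intro integral_add L1_integrable L1_mult_continuous c contg integrable_continuous_real continuous_intros contC g')
  moreover have "integral {0..1} (\<lambda>t. C t * g' t) = integral {0..1} (\<lambda>t. Q t * g' t)"
  proof -
    have "integral {0..1} g' = 0"
      using fundamental_theorem_of_calculus[of 0 1 g g'] g g0 g1 by (simp add: integral_unique)
    moreover have "integral {0..1} (\<lambda>t. Q t * g' t) = integral {0..1} (\<lambda>t. Q 0 * g' t + C t * g' t)"
    proof (rule integral_cong)
      fix t :: real assume "t \<in> {0..1}"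
      from QC[OF this] show "Q t * g' t = Q 0 * g' t + C t * g' t"
        by (simp only: distrib_right)
    qed
    moreover have "\<dots> = integral {0..1} (\<lambda>t. Q 0 * g' t) + integral {0..1} (\<lambda>t. C t * g' t)"
      by (intro integral_add integrable_continuous_real continuous_intros contC g')
    ultimately show ?thesis by simp
  qed
  ultimately show ?thesis by (simp add: eq_neg_iff_add_eq_0)
qed

section \<open>Leibniz rule, test functions and approximation by polynomials\<close>

text \<open>The arguments are jets at a single point, not functions. Quasi-derivatives, polynomial
  derivatives and derivatives of test functions can all be inserted without asking whether
  \<open>vderiv\<close> is meaningful for them.\<close>

definition leibniz :: "nat \<Rightarrow> (nat \<Rightarrow> complex) \<Rightarrow> (nat \<Rightarrow> complex) \<Rightarrow> complex" where
  "leibniz i u v = (\<Sum>j\<le>i. of_nat (i choose j) * (u j * v (i - j)))"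

text \<open>Pascal's rule, in the shape that the product rule produces from each summand of
  \<open>leibniz i\<close>.\<close>

lemma leibniz_Suc:
  "leibniz (Suc i) u v = (\<Sum>j\<le>i. of_nat (i choose j) * (u (Suc j) * v (i - j) + u j * v (Suc i - j)))"
proof -
  have shift: "(\<Sum>j\<le>Suc i. of_nat (i choose j) * (u j * v (Suc i - j)))
      = u 0 * v (Suc i) + (\<Sum>j\<le>i. of_nat (i choose Suc j) * (u (Suc j) * v (i - j)))"
    by (subst sum.atMost_Suc_shift) simp
  have "leibniz (Suc i) u v
      = u 0 * v (Suc i) + (\<Sum>j\<le>i. of_nat (Suc i choose Suc j) * (u (Suc j) * v (i - j)))"
    unfolding leibniz_def by (subst sum.atMost_Suc_shift) simp
  also have "\<dots> = u 0 * v (Suc i) + (\<Sum>j\<le>i. of_nat (i choose j) * (u (Suc j) * v (i - j)))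
      + (\<Sum>j\<le>i. of_nat (i choose Suc j) * (u (Suc j) * v (i - j)))"
    by (simp add: sum.distrib distrib_right)
  also have "u 0 * v (Suc i) + (\<Sum>j\<le>i. of_nat (i choose j) * (u (Suc j) * v (i - j)))
      + (\<Sum>j\<le>i. of_nat (i choose Suc j) * (u (Suc j) * v (i - j)))
      = (\<Sum>j\<le>i. of_nat (i choose j) * (u (Suc j) * v (i - j)))
      + (\<Sum>j\<le>Suc i. of_nat (i choose j) * (u j * v (Suc i - j)))"
    by (subst shift) simp
  also have "\<dots> = (\<Sum>j\<le>i. of_nat (i choose j) * (u (Suc j) * v (i - j) + u j * v (Suc i - j)))"
    by (simp add: sum.distrib distrib_left)
  finally show ?thesis .
qed

lemma leibniz_has_vector_derivative:
  fixes u v :: "nat \<Rightarrow> real \<Rightarrow> complex"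
  assumes "\<And>j. j \<le> i \<Longrightarrow> (u j has_vector_derivative u (Suc j) x) (at x within S)"
    and "\<And>j. j \<le> i \<Longrightarrow> (v j has_vector_derivative v (Suc j) x) (at x within S)"
  shows "((\<lambda>t. leibniz i (\<lambda>j. u j t) (\<lambda>j. v j t))
    has_vector_derivative leibniz (Suc i) (\<lambda>j. u j x) (\<lambda>j. v j x)) (at x within S)"
  unfolding leibniz_Suc unfolding leibniz_def
proof (rule has_vector_derivative_sum)
  fix j assume j: "j \<in> {..i}"
  have "((\<lambda>t. u j t * v (i - j) t) has_vector_derivative u j x * v (Suc (i - j)) x + u (Suc j) x * v (i - j) x) (at x within S)"
    using j by (intro has_vector_derivative_mult assms) auto
  from has_vector_derivative_mult_right[OF this, of "of_nat (i choose j)"]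
  show "((\<lambda>t. of_nat (i choose j) * (u j t * v (i - j) t)) has_vector_derivative
      of_nat (i choose j) * (u (Suc j) x * v (i - j) x + u j x * v (Suc i - j) x)) (at x within S)"
    using j by (simp add: Suc_diff_le add.commute)
qed

text \<open>\<open>vderiv\<close> is total and carries no information where a derivative fails to
  exist. Its iterates are therefore always identified through a candidate sequence \<open>w\<close>
  of genuine derivatives; openness of \<open>S\<close> makes the values of \<open>f\<close> outside
  \<open>S\<close> irrelevant.\<close>

lemma vderiv_funpow_eq:
  assumes S: "open S" and f: "\<And>x. x \<in> S \<Longrightarrow> f x = w 0 x"
    and w: "\<And>j x. j < n \<Longrightarrow> x \<in> S \<Longrightarrow> (w j has_vector_derivative w (Suc j) x) (at x)"
    and i: "i \<le> n" and x: "x \<in> S"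
  shows "(vderiv ^^ i) f x = w i x"
  using i x
proof (induction i arbitrary: x)
  case 0
  then show ?case by (simp add: f)
next
  case (Suc i)
  have "((vderiv ^^ i) f has_vector_derivative w (Suc i) x) (at x)"
  proof (rule has_vector_derivative_transform_within_open[OF w[of i x] S])
    show "w i y = (vderiv ^^ i) f y" if "y \<in> S" for y
      using Suc.IH[of y] Suc.prems that by simp
  qed (use Suc.prems in auto)
  then have "vderiv ((vderiv ^^ i) f) x = w (Suc i) x"
    unfolding vderiv_def[of "(vderiv ^^ i) f"] by (rule vector_derivative_at)
  then show ?case by simp
qed

section \<open>Test functions and their iterated derivatives\<close>

lemma test_function_has_vector_derivative:
  assumes "z \<in> test_functions"
  shows "((vderiv ^^ i) z has_vector_derivative (vderiv ^^ Suc i) z x) (at x within S)"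
  using assms by (auto simp: test_functions_def vderiv_def vector_derivative_works
      intro: has_vector_derivative_at_within)

lemma test_function_continuous:
  assumes "z \<in> test_functions"
  shows "continuous_on S ((vderiv ^^ i) z)"
  using test_function_has_vector_derivative[OF assms] by (rule continuous_on_vector_derivative)

lemma test_functionI:
  assumes w: "\<And>j x. (w j has_vector_derivative w (Suc j) x) (at x)"
    and supp: "closure {x. w 0 x \<noteq> 0} \<subseteq> {0<..<1}"
  shows "w 0 \<in> test_functions"
proof -
  have "(vderiv ^^ i) (w 0) = w i" for i
    using vderiv_funpow_eq[of UNIV "w 0" w i i] w by auto
  then have "(vderiv ^^ i) (w 0) differentiable (at x)" for i x
    using w[of i x] differentiableI_vector by metis
  then show ?thesis
    using supp by (simp add: test_functions_def)
qed

lemma test_function_vderiv: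
  assumes "z \<in> test_functions"
  shows "(vderiv ^^ k) z \<in> test_functions"
proof (induction k)
  case 0
  then show ?case using assms by simp
next
  case (Suc k)
  let ?w = "(vderiv ^^ k) z"
  have "vderiv ?w x = 0" if "x \<notin> closure {x. ?w x \<noteq> 0}" for x
  proof -
    have "(?w has_vector_derivative 0) (at x)"
      by (rule has_vector_derivative_transform_within_open[of "\<lambda>_. 0" _ _ "- closure {x. ?w x \<noteq> 0}"])
        (use that closure_subset[of "{x. ?w x \<noteq> 0}"] in auto)
    then show ?thesis by (simp add: vderiv_def vector_derivative_at)
  qed
  then have "closure {x. vderiv ?w x \<noteq> 0} \<subseteq> closure {x. ?w x \<noteq> 0}"
    by (intro closure_minimal) auto
  also have "\<dots> \<subseteq> {0<..<1}" using Suc by (simp add: test_functions_def)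
  finally have supp: "closure {x. (vderiv ^^ Suc k) z x \<noteq> 0} \<subseteq> {0<..<1}" by simp
  \<comment> \<open>The exponent is written \<open>0 + Suc k\<close> so that the claim is the member
    with index 0 of the shifted sequence.\<close>
  have "(vderiv ^^ (0 + Suc k)) z \<in> test_functions"
  proof (rule test_functionI[of "\<lambda>j. (vderiv ^^ (j + Suc k)) z"])
    show "((vderiv ^^ (j + Suc k)) z has_vector_derivative (vderiv ^^ (Suc j + Suc k)) z x) (at x)" for j x
      using test_function_has_vector_derivative[OF assms, of "j + Suc k" x UNIV] by simp
  qed (use supp in simp)
  then show ?case by simp
qed

lemma test_function_eq_0:
  assumes "z \<in> test_functions" "x \<notin> {0<..<1}"
  shows "(vderiv ^^ k) z x = 0"
proof -
  have "closure {x. (vderiv ^^ k) z x \<noteq> 0} \<subseteq> {0<..<1}"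
    using test_function_vderiv[OF assms(1), of k] by (simp add: test_functions_def)
  then have "{x. (vderiv ^^ k) z x \<noteq> 0} \<subseteq> {0<..<1}"
    by (rule order_trans[OF closure_subset])
  then show ?thesis using assms(2) by blast
qed

section \<open>Polynomials as multipliers of test functions and as approximants\<close>

lemma poly_has_vector_derivative:
  fixes p :: "complex poly"
  shows "((\<lambda>x. poly p (of_real x)) has_vector_derivative poly (pderiv p) (of_real x)) (at x within S)"
  by (rule has_vector_derivative_real_field[OF poly_DERIV])

lemma poly_mult_test_function:
  fixes p :: "complex poly"
  assumes z: "z \<in> test_functions"
  shows "(\<lambda>x. poly p (of_real x) * z x) \<in> test_functions"
    and "(vderiv ^^ i) (\<lambda>x. poly p (of_real x) * z x) x
      = leibniz i (\<lambda>j. poly ((pderiv ^^ j) p) (of_real x)) (\<lambda>j. (vderiv ^^ j) z x)"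
proof -
  define w where "w = (\<lambda>i x. leibniz i (\<lambda>j. poly ((pderiv ^^ j) p) (of_real x)) (\<lambda>j. (vderiv ^^ j) z x))"
  have w0: "w 0 = (\<lambda>x. poly p (of_real x) * z x)"
    by (simp add: w_def leibniz_def)
  have w: "(w j has_vector_derivative w (Suc j) x) (at x)" for j x
    unfolding w_def
  proof (rule leibniz_has_vector_derivative[where u = "\<lambda>j x. poly ((pderiv ^^ j) p) (of_real x)" and v = "\<lambda>j. (vderiv ^^ j) z"])
    show "((\<lambda>x. poly ((pderiv ^^ j) p) (of_real x)) has_vector_derivative poly ((pderiv ^^ Suc j) p) (of_real x)) (at x)" for j
      using poly_has_vector_derivative[of "(pderiv ^^ j) p"] by simp
  qed (rule test_function_has_vector_derivative[OF z])
  have "closure {x. w 0 x \<noteq> 0} \<subseteq> closure {x. z x \<noteq> 0}"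
    by (intro closure_mono) (auto simp: w0)
  then have "closure {x. w 0 x \<noteq> 0} \<subseteq> {0<..<1}"
    using z by (auto simp: test_functions_def)
  with w have "w 0 \<in> test_functions"
    by (rule test_functionI)
  then show "(\<lambda>x. poly p (of_real x) * z x) \<in> test_functions"
    by (simp add: w0)
  show "(vderiv ^^ i) (\<lambda>x. poly p (of_real x) * z x) x
      = leibniz i (\<lambda>j. poly ((pderiv ^^ j) p) (of_real x)) (\<lambda>j. (vderiv ^^ j) z x)"
  proof -
    have "(vderiv ^^ i) (w 0) x = w i x"
      using w by (intro vderiv_funpow_eq[where S = UNIV and n = i]) auto
    then show ?thesis unfolding w0 by (simp only: w_def)
  qed
qed

lemma ex_pderiv_eq:
  fixes p :: "'a :: field_char_0 poly"
  obtains q where "pderiv q = p" "poly q 0 = a"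
proof
  let ?q = "(\<Sum>i\<le>degree p. monom (coeff p i / of_nat (Suc i)) (Suc i))"
  have "pderiv ?q = (\<Sum>i\<le>degree p. monom (coeff p i) i)"
    using higher_pderiv_sum[of 1 "\<lambda>i. monom (coeff p i / of_nat (Suc i)) (Suc i)" "{..degree p}"]
    by (simp add: pderiv_monom del: of_nat_Suc)
  then show "pderiv (?q + [:a:]) = p"
    by (simp add: pderiv_add poly_as_sum_of_monoms pderiv_pCons)
  show "poly (?q + [:a:]) 0 = a"
    by (simp add: poly_sum poly_monom)
qed

text \<open>Passing from \<open>polynomial_function\<close> to a genuine \<open>complex poly\<close>
  makes iterated \<open>pderiv\<close> and polynomial antiderivatives available. The real and
  imaginary parts are turned into polynomials separately.\<close>

lemma Weierstrass_complex_poly: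
  fixes f :: "real \<Rightarrow> complex"
  assumes "continuous_on {0..1} f" "0 < e"
  obtains p where "\<And>x. x \<in> {0..1} \<Longrightarrow> norm (poly p (of_real x) - f x) \<le> e"
proof -
  obtain g where g: "polynomial_function g" "\<And>x. x \<in> {0..1} \<Longrightarrow> norm (f x - g x) < e"
    using Stone_Weierstrass_polynomial_function[OF compact_Icc assms] by blast
  have "real_polynomial_function (Re \<circ> g)" "real_polynomial_function (Im \<circ> g)"
    using g(1) by (auto simp: polynomial_function_def bounded_linear_Re bounded_linear_Im)
  then obtain a n b l where "Re \<circ> g = (\<lambda>x. \<Sum>i\<le>n. a i * x ^ i)" "Im \<circ> g = (\<lambda>x. \<Sum>i\<le>l. b i * x ^ i)"
    unfolding real_polynomial_function_iff_sum by (metis (no_types))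
  then have re: "Re (g x) = (\<Sum>i\<le>n. a i * x ^ i)" and im: "Im (g x) = (\<Sum>i\<le>(l::nat). b i * x ^ i)" for x :: real
    by (metis comp_apply)+
  let ?p = "(\<Sum>i\<le>n. monom (of_real (a i)) i) + [:\<i>:] * (\<Sum>i\<le>l. monom (of_real (b i)) i)"
  have "poly ?p (of_real x) = g x" for x
    by (simp add: complex_eq_iff poly_sum poly_monom re im flip: of_real_power of_real_mult)
  then show ?thesis
    using g(2) by (intro that[of ?p]) (auto simp: norm_minus_commute less_imp_le)
qed

text \<open>The highest derivative is approximated uniformly and then integrated \<open>i\<close>
  times, each time matching the value at 0. The interval has length one, so integration does not
  enlarge the error and the same \<open>e\<close> serves every order.\<close>

lemma poly_derivs_approximation:
  fixes u :: "nat \<Rightarrow> real \<Rightarrow> complex"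
  assumes "0 < e"
    and "\<And>j x. j < i \<Longrightarrow> x \<in> {0..1} \<Longrightarrow> (u j has_vector_derivative u (Suc j) x) (at x within {0..1})"
    and "continuous_on {0..1} (u i)"
  obtains p where "\<And>j x. j \<le> i \<Longrightarrow> x \<in> {0..1} \<Longrightarrow> norm (poly ((pderiv ^^ j) p) (of_real x) - u j x) \<le> e"
  using assms(2,3)
proof (induction i arbitrary: u thesis)
  case 0
  obtain p where "\<And>x. x \<in> {0..1} \<Longrightarrow> norm (poly p (of_real x) - u 0 x) \<le> e"
    using Weierstrass_complex_poly[OF 0(3) \<open>0 < e\<close>] by blast
  then show ?case by (intro 0(1)[of p]) auto
next
  case (Suc i)
  obtain p where p: "norm (poly ((pderiv ^^ j) p) (of_real x) - u (Suc j) x) \<le> e" if "j \<le> i" "x \<in> {0..1}" for j x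
    using Suc.IH[of "\<lambda>j. u (Suc j)"] Suc.prems(2,3) by blast
  obtain q where q: "pderiv q = p" "poly q 0 = u 0 0"
    by (rule ex_pderiv_eq)
  have *: "norm (poly q (of_real x) - u 0 x) \<le> e" if x: "x \<in> {0..1}" for x
  proof -
    let ?f = "\<lambda>x. poly q (of_real x) - u 0 x"
    have "norm (?f x - ?f 0) \<le> e * norm (x - 0)"
    proof (rule differentiable_bound[where S = "{0..1}" and f' = "\<lambda>x h. h *\<^sub>R (poly p (of_real x) - u (Suc 0) x)"])
      fix t :: real assume t: "t \<in> {0..1}"
      show "(?f has_derivative (\<lambda>h. h *\<^sub>R (poly p (of_real t) - u (Suc 0) t))) (at t within {0..1})"
        using has_vector_derivative_diff[OF poly_has_vector_derivative[of q t "{0..1}"] Suc.prems(2)[of 0 t]] t q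
        by (simp add: has_vector_derivative_def)
      show "onorm (\<lambda>h. h *\<^sub>R (poly p (of_real t) - u (Suc 0) t)) \<le> e"
        using p[of 0 t] t by (intro onorm_le) (auto simp: mult.commute[of e] intro!: mult_left_mono)
    qed (use x in auto)
    also have "\<dots> \<le> e" using x \<open>0 < e\<close> by (simp add: mult_left_le)
    finally show ?thesis using q by simp
  qed
  show ?case
  proof (rule Suc.prems(1)[of q])
    fix j x assume "j \<le> Suc i" and x: "(x::real) \<in> {0..1}"
    show "norm (poly ((pderiv ^^ j) q) (of_real x) - u j x) \<le> e"
    proof (cases j)
      case (Suc k)
      have "(pderiv ^^ Suc k) q = (pderiv ^^ k) p"
        by (simp add: funpow_Suc_right q del: funpow.simps)
      with p[of k x] Suc \<open>j \<le> Suc i\<close> \<open>x \<in> {0..1}\<close> show ?thesis by (simp del: funpow.simps)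
    qed (use x in \<open>simp add: *\<close>)
  qed
qed

text \<open>At the endpoints \<open>vderiv\<close> also sees values outside \<open>[0,1]\<close>,
  where the functions concerned are arbitrary; identities between derivatives are available only in
  the open interval.\<close>

lemma integral_cong_interior:
  fixes f g :: "real \<Rightarrow> complex"
  assumes "\<And>x. x \<in> {0<..<1} \<Longrightarrow> f x = g x"
  shows "integral {0..1} f = integral {0..1} g"
  by (rule integral_spike[of "{0,1}"]) (auto simp: assms)

section \<open>Distributions and their products\<close>

lemma dderiv_funpow: "(dderiv ^^ k) T z = (-1) ^ k * T ((vderiv ^^ k) z)"
proof (induction k arbitrary: z)
  case (Suc k)
  have "(dderiv ^^ Suc k) T z = - (dderiv ^^ k) T (vderiv z)"
    by (simp add: dderiv_def[of "(dderiv ^^ k) T"])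
  also have "\<dots> = (-1) ^ Suc k * T ((vderiv ^^ k) (vderiv z))"
    by (simp add: Suc.IH)
  finally show ?case
    by (simp only: funpow_Suc_right o_apply)
qed simp

lemma vderiv_funpow_lincomb:
  assumes "z \<in> test_functions" "w \<in> test_functions"
  shows "(vderiv ^^ i) (\<lambda>x. a * z x + b * w x) = (\<lambda>x. a * (vderiv ^^ i) z x + b * (vderiv ^^ i) w x)"
proof
  fix x
  show "(vderiv ^^ i) (\<lambda>x. a * z x + b * w x) x = a * (vderiv ^^ i) z x + b * (vderiv ^^ i) w x"
  proof (rule vderiv_funpow_eq[where S = UNIV and n = i
        and w = "\<lambda>i x. a * (vderiv ^^ i) z x + b * (vderiv ^^ i) w x"])
    show "((\<lambda>x. a * (vderiv ^^ j) z x + b * (vderiv ^^ j) w x) has_vector_derivative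
        a * (vderiv ^^ Suc j) z x + b * (vderiv ^^ Suc j) w x) (at x)" for j x
      by (intro has_vector_derivative_add has_vector_derivative_mult_right
          test_function_has_vector_derivative assms)
  qed auto
qed

lemma integral_lincomb_mult:
  assumes "\<sigma> \<in> L1" "continuous_on {0..1} f" "continuous_on {0..1} g"
  shows "integral {0..1} (\<lambda>x. \<sigma> x * (a * f x + b * g x))
    = a * integral {0..1} (\<lambda>x. \<sigma> x * f x) + b * integral {0..1} (\<lambda>x. \<sigma> x * g x)"
proof -
  have "integral {0..1} (\<lambda>x. \<sigma> x * (a * f x + b * g x))
    = integral {0..1} (\<lambda>x. a * (\<sigma> x * f x) + b * (\<sigma> x * g x))"
    by (simp add: algebra_simps)
  also have "\<dots> = integral {0..1} (\<lambda>x. a * (\<sigma> x * f x)) + integral {0..1} (\<lambda>x. b * (\<sigma> x * g x))"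
    by (intro integral_add L1_integrable L1_cmult L1_mult_continuous assms)
  finally show ?thesis by simp
qed

lemma norm_integral_mult_le:
  assumes "\<sigma> \<in> L1" "continuous_on {0..1} f" "\<And>x. x \<in> {0..1} \<Longrightarrow> norm (f x) \<le> B"
  shows "norm (integral {0..1} (\<lambda>x. \<sigma> x * f x)) \<le> integral {0..1} (\<lambda>x. norm (\<sigma> x)) * B"
proof -
  have nint: "(\<lambda>t. norm (\<sigma> t)) integrable_on {0..1}"
    using assms(1) by (simp add: L1_def absolutely_integrable_on_def)
  have "norm (integral {0..1} (\<lambda>x. \<sigma> x * f x)) \<le> integral {0..1} (\<lambda>x. norm (\<sigma> x) * B)"
    by (intro integral_norm_bound_integral L1_integrable L1_mult_continuous integrable_on_mult_left nint assms)
      (use assms(3) in \<open>auto simp: norm_mult intro: mult_left_mono\<close>)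
  then show ?thesis by simp
qed

lemma dderiv_regular_in_W_neg:
  assumes \<sigma>: "\<sigma> \<in> L1"
  shows "(dderiv ^^ i) (regular \<sigma>) \<in> W_neg i"
proof -
  let ?T = "(dderiv ^^ i) (regular \<sigma>)"
  have T: "?T z = (-1) ^ i * integral {0..1} (\<lambda>x. \<sigma> x * (vderiv ^^ i) z x)" for z
    by (simp add: dderiv_funpow regular_def)
  have lin: "?T (\<lambda>x. a * z x + b * w x) = a * ?T z + b * ?T w"
    if "z \<in> test_functions" "w \<in> test_functions" for a b z w
    unfolding T vderiv_funpow_lincomb[OF that]
    by (simp only: integral_lincomb_mult[OF \<sigma> test_function_continuous test_function_continuous] that)
      (simp add: algebra_simps)
  have "\<exists>C N. \<forall>z\<in>test_functions. (\<forall>x. x \<notin> {a..b} \<longrightarrow> z x = 0) \<longrightarrow>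
      norm (?T z) \<le> C * (\<Sum>j\<le>N. SUP x\<in>{a..b}. norm ((vderiv ^^ j) z x))"
    if ab: "0 < a" "a < b" "b < 1" for a b :: real
  \<comment> \<open>The witnesses stay schematic until the final \<open>show\<close>, which takes
    the L1 norm of \<open>\<sigma>\<close> for \<open>C\<close> and \<open>i\<close> for
    \<open>N\<close>; neither depends on \<open>z\<close>.\<close>
  proof (intro exI ballI impI)
    fix z assume z: "z \<in> test_functions" and supp: "\<forall>x. x \<notin> {a..b} \<longrightarrow> z x = 0"
    have bdd: "bdd_above ((\<lambda>x. norm ((vderiv ^^ j) z x)) ` {a..b})" for j
      by (intro bounded_imp_bdd_above compact_imp_bounded compact_continuous_image
          continuous_intros test_function_continuous z compact_Icc)
    have le: "norm ((vderiv ^^ j) z x) \<le> (SUP x\<in>{a..b}. norm ((vderiv ^^ j) z x))" if "x \<in> {a..b}" for j x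
      using that by (intro cSUP_upper bdd)
    have nonneg: "0 \<le> (SUP x\<in>{a..b}. norm ((vderiv ^^ j) z x))" for j
      using le[of a j] ab by (intro order_trans[OF norm_ge_zero]) auto
    have out: "(vderiv ^^ i) z x = 0" if "x \<notin> {a..b}" for x
      using that supp
      by (intro vderiv_funpow_eq[of "- {a..b}" z "\<lambda>_ _. 0" i i x]) auto
    have "norm ((vderiv ^^ i) z x) \<le> (\<Sum>j\<le>i. SUP x\<in>{a..b}. norm ((vderiv ^^ j) z x))" for x
    proof (cases "x \<in> {a..b}")
      case True
      have "(SUP x\<in>{a..b}. norm ((vderiv ^^ i) z x)) \<le> (\<Sum>j\<le>i. SUP x\<in>{a..b}. norm ((vderiv ^^ j) z x))"
        by (rule member_le_sum) (auto simp: nonneg)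
      with le[OF True, of i] show ?thesis by linarith
    qed (simp add: out sum_nonneg nonneg)
    then have "norm (integral {0..1} (\<lambda>x. \<sigma> x * (vderiv ^^ i) z x))
        \<le> integral {0..1} (\<lambda>x. norm (\<sigma> x)) * (\<Sum>j\<le>i. SUP x\<in>{a..b}. norm ((vderiv ^^ j) z x))"
      by (intro norm_integral_mult_le \<sigma> test_function_continuous z)
    then show "norm (?T z) \<le> integral {0..1} (\<lambda>x. norm (\<sigma> x)) * (\<Sum>j\<le>i. SUP x\<in>{a..b}. norm ((vderiv ^^ j) z x))"
      by (simp add: T norm_mult norm_power)
  qed
  moreover have "?T (\<lambda>x. z x + w x) = ?T z + ?T w" if "z \<in> test_functions" "w \<in> test_functions" for z w
    using lin[OF that, of 1 1] by simp
  moreover have "?T (\<lambda>x. c * z x) = c * ?T z" if "z \<in> test_functions" for c z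
    using lin[OF that that, of c 0] by simp
  ultimately have "?T \<in> distributions"
    unfolding distributions_def by blast
  then show ?thesis
    using \<sigma> by (auto simp: W_neg_def dist_eq_def)
qed

section \<open>Independence of the product from the chosen primitive\<close>

lemma continuous_on_leibniz:
  fixes u v :: "nat \<Rightarrow> real \<Rightarrow> complex"
  assumes "\<And>j. j \<le> i \<Longrightarrow> continuous_on S (u j)" "\<And>j. j \<le> i \<Longrightarrow> continuous_on S (v j)"
  shows "continuous_on S (\<lambda>x. leibniz i (\<lambda>j. u j x) (\<lambda>j. v j x))"
  unfolding leibniz_def by (intro continuous_intros assms) auto

text \<open>Approximating \<open>u\<close> together with its derivatives by polynomials, a product of \<open>u\<close> with a
  test function is a limit of test functions, and no mollification is needed.\<close>

lemma annihilates_leibniz: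
  fixes u :: "nat \<Rightarrow> real \<Rightarrow> complex"
  assumes \<rho>: "\<rho> \<in> L1"
    and ann: "\<And>z. z \<in> test_functions \<Longrightarrow> integral {0..1} (\<lambda>x. \<rho> x * (vderiv ^^ i) z x) = 0"
    and z: "z \<in> test_functions"
    and u: "\<And>j x. j < i \<Longrightarrow> x \<in> {0..1} \<Longrightarrow> (u j has_vector_derivative u (Suc j) x) (at x within {0..1})"
    and ui: "continuous_on {0..1} (u i)"
  shows "integral {0..1} (\<lambda>x. \<rho> x * leibniz i (\<lambda>j. u j x) (\<lambda>j. (vderiv ^^ j) z x)) = 0" (is "?I = 0")
proof -
  let ?R = "integral {0..1} (\<lambda>x. norm (\<rho> x))"
  have contu: "continuous_on {0..1} (u j)" if "j \<le> i" for j
    using that ui continuous_on_vector_derivative[of "{0..1}" "u j" "u (Suc j)"] u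
    by (cases "j = i") auto
  have "\<exists>B. \<forall>x\<in>{0..1}. norm ((vderiv ^^ j) z x) \<le> B" for j
    using compact_imp_bounded[OF compact_continuous_image[OF test_function_continuous[OF z, of "{0..1}" j] compact_Icc]]
    unfolding bounded_iff by blast
  then obtain b where b: "norm ((vderiv ^^ j) z x) \<le> b j" if "x \<in> {0..1}" for j x
    by metis
  have b0: "0 \<le> b j" for j
    using b[of 0 j] by (intro order_trans[OF norm_ge_zero]) auto
  \<comment> \<open>\<open>M\<close> is the factor by which an error \<open>e\<close> in all
    derivatives of \<open>u\<close> is multiplied in the Leibniz sum with \<open>z\<close>.\<close>
  define M where "M = (\<Sum>j\<le>i. of_nat (i choose j) * b (i - j))"
  have M0: "0 \<le> M" unfolding M_def by (intro sum_nonneg mult_nonneg_nonneg b0) auto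
  have R0: "0 \<le> ?R" by (rule Henstock_Kurzweil_Integration.integral_nonneg)
      (use \<rho> in \<open>auto simp: L1_def absolutely_integrable_on_def\<close>)
  have bound: "norm ?I \<le> e * (?R * M)" if e: "0 < e" for e
  proof -
    obtain p where p: "norm (poly ((pderiv ^^ j) p) (of_real x) - u j x) \<le> e" if "j \<le> i" "x \<in> {0..1}" for j x
      using poly_derivs_approximation[OF e u ui] by blast
    let ?P = "\<lambda>x. leibniz i (\<lambda>j. poly ((pderiv ^^ j) p) (of_real x)) (\<lambda>j. (vderiv ^^ j) z x)"
    let ?U = "\<lambda>x. leibniz i (\<lambda>j. u j x) (\<lambda>j. (vderiv ^^ j) z x)"
    have contP: "continuous_on {0..1} ?P"
      by (rule continuous_on_leibniz[where u = "\<lambda>j x. poly ((pderiv ^^ j) p) (of_real x)" and v = "\<lambda>j. (vderiv ^^ j) z"])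
        (auto intro!: test_function_continuous z continuous_intros)
    have contU: "continuous_on {0..1} ?U"
      by (rule continuous_on_leibniz[where u = u and v = "\<lambda>j. (vderiv ^^ j) z"])
        (auto intro!: test_function_continuous z contu)
    have "integral {0..1} (\<lambda>x. \<rho> x * ?P x) = 0"
      using ann[OF poly_mult_test_function(1)[OF z, of p]] by (simp only: poly_mult_test_function(2)[OF z])
    then have I: "?I = integral {0..1} (\<lambda>x. \<rho> x * (?U x - ?P x))"
      using integral_lincomb_mult[OF \<rho> contU contP, of 1 "-1"] by simp
    have "norm (?U x - ?P x) \<le> e * M" if x: "x \<in> {0..1}" for x
    proof -
      have "?U x - ?P x = (\<Sum>j\<le>i. of_nat (i choose j) * ((u j x - poly ((pderiv ^^ j) p) (of_real x)) * (vderiv ^^ (i - j)) z x))"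
        unfolding leibniz_def by (simp add: sum_subtractf algebra_simps)
      also have "norm \<dots> \<le> (\<Sum>j\<le>i. of_nat (i choose j) * (e * b (i - j)))"
        by (intro sum_norm_le) (use p x b b0 e in \<open>auto simp: norm_mult norm_minus_commute intro!: mult_left_mono mult_mono\<close>)
      also have "\<dots> = e * M" by (simp add: M_def sum_distrib_left mult_ac)
      finally show ?thesis .
    qed
    then have "norm ?I \<le> ?R * (e * M)"
      unfolding I by (intro norm_integral_mult_le \<rho> continuous_intros contU contP)
    then show ?thesis by (simp add: mult_ac)
  qed
  have "norm ?I \<le> 0 + d" if d: "0 < d" for d
  proof -
    \<comment> \<open>The summand 1 keeps the denominator positive, since \<open>?R * M\<close> may
      be zero.\<close>
    have "norm ?I \<le> d / (?R * M + 1) * (?R * M)"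
      using d M0 R0 by (intro bound divide_pos_pos) (auto intro: add_nonneg_pos)
    also have "\<dots> \<le> d"
      using d mult_nonneg_nonneg[OF R0 M0] by (simp add: divide_simps add_nonneg_pos mult_left_mono)
    finally show ?thesis by simp
  qed
  then have "norm ?I \<le> 0" by (rule field_le_epsilon)
  then show ?thesis by simp
qed

text \<open>The \<open>SOME\<close> in \<open>dist_mult\<close> may select a primitive other than
  \<open>\<sigma>\<close>. The difference of the two annihilates all \<open>i\<close>-th derivatives
  of test functions, and \<open>annihilates_leibniz\<close> extends this to \<open>i\<close>-th
  derivatives of products of a test function with a factor of finite smoothness. It is never
  necessary to identify the difference as a polynomial.\<close>

lemma dist_mult_eq:
  fixes u :: "nat \<Rightarrow> real \<Rightarrow> complex"
  assumes \<sigma>: "\<sigma> \<in> L1" and \<tau>: "dist_eq \<tau> ((dderiv ^^ i) (regular \<sigma>))"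
    and z: "z \<in> test_functions"
    and g: "\<And>x. x \<in> {0<..<1} \<Longrightarrow> g x = u 0 x"
    and u: "\<And>j x. j < i \<Longrightarrow> x \<in> {0..1} \<Longrightarrow> (u j has_vector_derivative u (Suc j) x) (at x within {0..1})"
    and ui: "continuous_on {0..1} (u i)"
  shows "dist_mult i \<tau> g z = (-1) ^ i * integral {0..1} (\<lambda>x. \<sigma> x * leibniz i (\<lambda>j. u j x) (\<lambda>j. (vderiv ^^ j) z x))"
proof -
  let ?U = "\<lambda>x. leibniz i (\<lambda>j. u j x) (\<lambda>j. (vderiv ^^ j) z x)"
  define s where "s = (SOME \<sigma>. \<sigma> \<in> L1 \<and> dist_eq \<tau> ((dderiv ^^ i) (regular \<sigma>)))"
  have s: "s \<in> L1" "dist_eq \<tau> ((dderiv ^^ i) (regular s))"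
    using someI[of "\<lambda>\<sigma>. \<sigma> \<in> L1 \<and> dist_eq \<tau> ((dderiv ^^ i) (regular \<sigma>))" \<sigma>] \<sigma> \<tau> by (auto simp: s_def)
  have contu: "continuous_on {0..1} (u j)" if "j \<le> i" for j
    using that ui continuous_on_vector_derivative[of "{0..1}" "u j" "u (Suc j)"] u
    by (cases "j = i") auto
  have contU: "continuous_on {0..1} ?U"
    by (rule continuous_on_leibniz[where u = u and v = "\<lambda>j. (vderiv ^^ j) z"])
      (auto intro!: test_function_continuous z contu)
  have diff: "integral {0..1} (\<lambda>x. (s x - \<sigma> x) * f x) = integral {0..1} (\<lambda>x. s x * f x) - integral {0..1} (\<lambda>x. \<sigma> x * f x)"
    if "continuous_on {0..1} f" for f
    unfolding left_diff_distrib by (intro integral_diff L1_integrable L1_mult_continuous s \<sigma> that)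
  have "integral {0..1} (\<lambda>x. (s x - \<sigma> x) * ?U x) = 0"
  proof (rule annihilates_leibniz[OF L1_diff[OF s(1) \<sigma>] _ z u ui])
    fix w assume w: "w \<in> test_functions"
    then have "(dderiv ^^ i) (regular s) w = (dderiv ^^ i) (regular \<sigma>) w"
      using s(2) \<tau> by (simp add: dist_eq_def)
    then show "integral {0..1} (\<lambda>x. (s x - \<sigma> x) * (vderiv ^^ i) w x) = 0"
      by (simp add: diff test_function_continuous[OF w] dderiv_funpow regular_def)
  qed
  then have eq: "integral {0..1} (\<lambda>x. s x * ?U x) = integral {0..1} (\<lambda>x. \<sigma> x * ?U x)"
    by (simp add: diff contU)
  have "(vderiv ^^ i) (\<lambda>t. g t * z t) x = ?U x" if "x \<in> {0<..<1}" for x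
  proof (rule vderiv_funpow_eq[where S = "{0<..<1}" and n = i and w = "\<lambda>k x. leibniz k (\<lambda>j. u j x) (\<lambda>j. (vderiv ^^ j) z x)"])
    fix k and t :: real assume k: "k < i" and t: "t \<in> {0<..<1}"
    show "((\<lambda>x. leibniz k (\<lambda>j. u j x) (\<lambda>j. (vderiv ^^ j) z x)) has_vector_derivative
        leibniz (Suc k) (\<lambda>j. u j t) (\<lambda>j. (vderiv ^^ j) z t)) (at t)"
    proof (rule leibniz_has_vector_derivative)
      fix j assume "j \<le> k"
      have "(u j has_vector_derivative u (Suc j) t) (at t within {0<..<1})"
        using \<open>j \<le> k\<close> k t by (intro has_vector_derivative_within_subset[OF u]) auto
      then show "(u j has_vector_derivative u (Suc j) t) (at t)"
        using at_within_open[of t "{0<..<1}"] t by simp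
    qed (rule test_function_has_vector_derivative[OF z])
  qed (use that g in \<open>auto simp: leibniz_def\<close>)
  then have "integral {0..1} (\<lambda>x. s x * (vderiv ^^ i) (\<lambda>t. g t * z t) x) = integral {0..1} (\<lambda>x. s x * ?U x)"
    by (intro integral_cong_interior) simp
  then show ?thesis
    by (simp add: dist_mult_def eq flip: s_def)
qed

section \<open>Bilinear functionals of jets\<close>

text \<open>Models \<open>u\<close> on the quasi-derivatives of \<open>y\<close> and
  \<open>v\<close> on the derivatives of a test function. Entries \<open>u j\<close> with
  \<open>j > m\<close> are left free, since quasi-derivatives beyond order \<open>m\<close> are no
  longer classical derivatives of \<open>y\<close>.\<close>

definition jet_pair :: "nat \<Rightarrow> (nat \<Rightarrow> real \<Rightarrow> complex) \<Rightarrow> (nat \<Rightarrow> real \<Rightarrow> complex) \<Rightarrow> bool" where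
  "jet_pair m u v \<longleftrightarrow>
     (\<forall>j<m. \<forall>x\<in>{0..1}. (u j has_vector_derivative u (Suc j) x) (at x within {0..1})) \<and>
     continuous_on {0..1} (u m) \<and>
     (\<forall>j. \<forall>x\<in>{0..1}. (v j has_vector_derivative v (Suc j) x) (at x within {0..1})) \<and>
     (\<forall>j. v j 0 = 0 \<and> v j 1 = 0)"

lemma jet_pair_continuous:
  assumes "jet_pair m u v"
  shows "j \<le> m \<Longrightarrow> continuous_on {0..1} (u j)" "continuous_on {0..1} (v k)"
proof -
  show "continuous_on {0..1} (u j)" if "j \<le> m"
    using assms continuous_on_vector_derivative[of "{0..1}" "u j" "u (Suc j)"] that
    by (cases "j = m") (auto simp: jet_pair_def)
  show "continuous_on {0..1} (v k)"
    using assms continuous_on_vector_derivative[of "{0..1}" "v k" "v (Suc k)"]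
    by (auto simp: jet_pair_def)
qed

type_synonym bilinear_functional = "(nat \<Rightarrow> real \<Rightarrow> complex) \<Rightarrow> (nat \<Rightarrow> real \<Rightarrow> complex) \<Rightarrow> complex"

definition moment :: "nat \<Rightarrow> nat \<Rightarrow> (real \<Rightarrow> complex) \<Rightarrow> bilinear_functional" where
  "moment a b c u v = integral {0..1} (\<lambda>x. c x * (u a x * v b x))"

text \<open>This is the term of \<open>ell\<close> with coefficient \<open>\<tau>\<close> of index
  \<open>2 * k\<close>, tested against \<open>z\<close>, when that coefficient is the
  \<open>(m - k)\<close>-th derivative of \<open>s\<close>. The sign in \<open>ell\<close> cancels
  against the \<open>k\<close> derivatives moved to \<open>z\<close>; the sign that remains belongs
  to the product.\<close>

definition even_form :: "nat \<Rightarrow> nat \<Rightarrow> (real \<Rightarrow> complex) \<Rightarrow> bilinear_functional" where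
  "even_form m k s u v = (-1) ^ (m - k) *
     integral {0..1} (\<lambda>x. s x * leibniz (m - k) (\<lambda>j. u (k + j) x) (\<lambda>j. v (k + j) x))"

text \<open>The analogue for index \<open>2 * k + 1\<close>. Its two parts move \<open>k + 1\<close>
  and \<open>k\<close> derivatives to \<open>z\<close> under the common sign
  \<open>(-1) ^ (k + 1)\<close>, which is why a sum in \<open>ell\<close> becomes a difference
  here.\<close>

definition odd_form :: "nat \<Rightarrow> nat \<Rightarrow> (real \<Rightarrow> complex) \<Rightarrow> bilinear_functional" where
  "odd_form m k s u v = (-1) ^ (m - k - 1) *
     (integral {0..1} (\<lambda>x. s x * leibniz (m - k - 1) (\<lambda>j. u (k + j) x) (\<lambda>j. v (Suc k + j) x))
      - integral {0..1} (\<lambda>x. s x * leibniz (m - k - 1) (\<lambda>j. u (Suc k + j) x) (\<lambda>j. v (k + j) x)))"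

definition canonical_form :: "nat \<Rightarrow> (nat \<Rightarrow> real \<Rightarrow> complex) \<Rightarrow> bilinear_functional" where
  "canonical_form m \<sigma> u v =
     (\<Sum>k\<le>m. even_form m k (\<sigma> (2 * k)) u v) + (\<Sum>k<m. odd_form m k (\<sigma> (2 * k + 1)) u v)"

text \<open>The order of the quantifiers is essential: one family \<open>\<sigma>\<close> has to
  serve all jets, because it will yield the coefficients, which must not depend on \<open>y\<close>
  or \<open>z\<close>.\<close>

definition representable :: "nat \<Rightarrow> bilinear_functional \<Rightarrow> bool" where
  "representable m \<Phi> \<longleftrightarrow>
     (\<exists>\<sigma>. (\<forall>\<nu>. \<sigma> \<nu> \<in> L1) \<and> (\<forall>u v. jet_pair m u v \<longrightarrow> \<Phi> u v = canonical_form m \<sigma> u v))"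

lemma integral_mult_leibniz:
  fixes u v :: "nat \<Rightarrow> real \<Rightarrow> complex"
  assumes "c \<in> L1" "\<And>j. j \<le> i \<Longrightarrow> continuous_on {0..1} (u j)" "\<And>j. j \<le> i \<Longrightarrow> continuous_on {0..1} (v j)"
  shows "integral {0..1} (\<lambda>x. c x * leibniz i (\<lambda>j. u j x) (\<lambda>j. v j x))
    = (\<Sum>j\<le>i. of_nat (i choose j) * moment j (i - j) c u v)"
proof -
  have "integral {0..1} (\<lambda>x. c x * leibniz i (\<lambda>j. u j x) (\<lambda>j. v j x))
      = integral {0..1} (\<lambda>x. \<Sum>j\<le>i. of_nat (i choose j) * (c x * (u j x * v (i - j) x)))"
    by (simp add: leibniz_def sum_distrib_left mult_ac)
  also have "\<dots> = (\<Sum>j\<le>i. integral {0..1} (\<lambda>x. of_nat (i choose j) * (c x * (u j x * v (i - j) x))))"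
    using assms
    by (intro integral_sum L1_integrable L1_cmult L1_mult_continuous continuous_intros) auto
  finally show ?thesis by (simp add: moment_def)
qed

text \<open>The extreme indices \<open>j = 0\<close> and \<open>j = m - k\<close> give the boundary
  pairs \<open>(k, m)\<close> and \<open>(m, k)\<close>, both with binomial coefficient one.\<close>

lemma even_form_eq_sum:
  assumes "jet_pair m u v" "s \<in> L1" "k \<le> m"
  shows "even_form m k s u v
    = (-1) ^ (m - k) * (\<Sum>j\<le>m - k. of_nat (m - k choose j) * moment (k + j) (m - j) s u v)"
proof -
  have "integral {0..1} (\<lambda>x. s x * leibniz (m - k) (\<lambda>j. u (k + j) x) (\<lambda>j. v (k + j) x))
    = (\<Sum>j\<le>m - k. of_nat (m - k choose j) * moment j (m - k - j) s (\<lambda>j. u (k + j)) (\<lambda>j. v (k + j)))"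
    using assms by (intro integral_mult_leibniz jet_pair_continuous[OF assms(1)]) auto
  also have "\<dots> = (\<Sum>j\<le>m - k. of_nat (m - k choose j) * moment (k + j) (m - j) s u v)"
    using assms by (intro sum.cong) (auto simp: moment_def)
  finally show ?thesis by (simp add: even_form_def)
qed

text \<open>Here \<open>(k, m)\<close> occurs only in the first sum, at \<open>j = 0\<close>, and
  \<open>(m, k)\<close> only in the second, at \<open>j = m - k - 1\<close>; all other pairs have
  both orders below \<open>m\<close>.\<close>

lemma odd_form_eq_sum:
  assumes "jet_pair m u v" "s \<in> L1" "k < m"
  shows "odd_form m k s u v = (-1) ^ (m - k - 1) *
    ((\<Sum>j\<le>m - k - 1. of_nat (m - k - 1 choose j) * moment (k + j) (m - j) s u v)
     - (\<Sum>j\<le>m - k - 1. of_nat (m - k - 1 choose j) * moment (Suc k + j) (m - 1 - j) s u v))"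
proof -
  have "integral {0..1} (\<lambda>x. s x * leibniz (m - k - 1) (\<lambda>j. u (k + j) x) (\<lambda>j. v (Suc k + j) x))
    = (\<Sum>j\<le>m - k - 1. of_nat (m - k - 1 choose j) * moment j (m - k - 1 - j) s (\<lambda>j. u (k + j)) (\<lambda>j. v (Suc k + j)))"
    using assms by (intro integral_mult_leibniz jet_pair_continuous[OF assms(1)]) auto
  also have "\<dots> = (\<Sum>j\<le>m - k - 1. of_nat (m - k - 1 choose j) * moment (k + j) (m - j) s u v)"
    using assms by (intro sum.cong) (auto simp: moment_def Suc_diff_Suc simp flip: diff_Suc_eq_diff_pred)
  finally have 1: "integral {0..1} (\<lambda>x. s x * leibniz (m - k - 1) (\<lambda>j. u (k + j) x) (\<lambda>j. v (Suc k + j) x)) = \<dots>" .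
  have "integral {0..1} (\<lambda>x. s x * leibniz (m - k - 1) (\<lambda>j. u (Suc k + j) x) (\<lambda>j. v (k + j) x))
    = (\<Sum>j\<le>m - k - 1. of_nat (m - k - 1 choose j) * moment j (m - k - 1 - j) s (\<lambda>j. u (Suc k + j)) (\<lambda>j. v (k + j)))"
    using assms by (intro integral_mult_leibniz jet_pair_continuous[OF assms(1)]) auto
  also have "\<dots> = (\<Sum>j\<le>m - k - 1. of_nat (m - k - 1 choose j) * moment (Suc k + j) (m - 1 - j) s u v)"
    using assms by (intro sum.cong) (auto simp: moment_def)
  finally show ?thesis unfolding odd_form_def 1 by simp
qed

lemma moment_lincomb:
  assumes "jet_pair m u v" "s \<in> L1" "t \<in> L1" "i \<le> m"
  shows "moment i j (\<lambda>x. a * s x + b * t x) u v = a * moment i j s u v + b * moment i j t u v"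
proof -
  have "moment i j (\<lambda>x. a * s x + b * t x) u v
    = integral {0..1} (\<lambda>x. a * (s x * (u i x * v j x)) + b * (t x * (u i x * v j x)))"
    by (simp add: moment_def algebra_simps)
  also have "\<dots> = integral {0..1} (\<lambda>x. a * (s x * (u i x * v j x))) + integral {0..1} (\<lambda>x. b * (t x * (u i x * v j x)))"
    by (intro integral_add L1_integrable L1_cmult L1_mult_continuous continuous_intros jet_pair_continuous[OF assms(1)] assms)
  finally show ?thesis by (simp add: moment_def)
qed

lemma canonical_form_lincomb:
  assumes uv: "jet_pair m u v" and \<sigma>: "\<And>\<nu>. \<sigma> \<nu> \<in> L1" and \<rho>: "\<And>\<nu>. \<rho> \<nu> \<in> L1"
  shows "canonical_form m (\<lambda>\<nu> x. a * \<sigma> \<nu> x + b * \<rho> \<nu> x) u v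
    = a * canonical_form m \<sigma> u v + b * canonical_form m \<rho> u v"
proof -
  have L: "(\<lambda>x. a * \<sigma> \<nu> x + b * \<rho> \<nu> x) \<in> L1" for \<nu>
    by (intro L1_add L1_cmult \<sigma> \<rho>)
  have "even_form m k (\<lambda>x. a * \<sigma> (2 * k) x + b * \<rho> (2 * k) x) u v
      = a * even_form m k (\<sigma> (2 * k)) u v + b * even_form m k (\<rho> (2 * k)) u v" if "k \<le> m" for k
    unfolding even_form_eq_sum[OF uv L that] even_form_eq_sum[OF uv \<sigma> that] even_form_eq_sum[OF uv \<rho> that]
    using that by (simp add: moment_lincomb[OF uv \<sigma> \<rho>] sum_distrib_left sum.distrib distrib_left mult_ac)
  moreover have "odd_form m k (\<lambda>x. a * \<sigma> (2 * k + 1) x + b * \<rho> (2 * k + 1) x) u v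
      = a * odd_form m k (\<sigma> (2 * k + 1)) u v + b * odd_form m k (\<rho> (2 * k + 1)) u v" if "k < m" for k
    unfolding odd_form_eq_sum[OF uv L that] odd_form_eq_sum[OF uv \<sigma> that] odd_form_eq_sum[OF uv \<rho> that]
    using that by (simp add: moment_lincomb[OF uv \<sigma> \<rho>] sum_distrib_left sum.distrib distrib_left right_diff_distrib mult_ac)
  ultimately show ?thesis
    by (simp add: canonical_form_def sum.distrib sum_distrib_left distrib_left)
qed

lemma representable_cong:
  assumes "representable m \<Phi>" "\<And>u v. jet_pair m u v \<Longrightarrow> \<Psi> u v = \<Phi> u v"
  shows "representable m \<Psi>"
  using assms unfolding representable_def by metis

lemma representable_lincomb:
  assumes "representable m \<Phi>" "representable m \<Psi>"
  shows "representable m (\<lambda>u v. a * \<Phi> u v + b * \<Psi> u v)"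
proof -
  obtain \<sigma> \<rho> where \<sigma>: "\<And>\<nu>. \<sigma> \<nu> \<in> L1" and \<Phi>: "\<And>u v. jet_pair m u v \<Longrightarrow> \<Phi> u v = canonical_form m \<sigma> u v"
    and \<rho>: "\<And>\<nu>. \<rho> \<nu> \<in> L1" and \<Psi>: "\<And>u v. jet_pair m u v \<Longrightarrow> \<Psi> u v = canonical_form m \<rho> u v"
    using assms unfolding representable_def by blast
  show ?thesis
    unfolding representable_def
  proof (intro exI conjI allI impI)
    show "(\<lambda>x. a * \<sigma> \<nu> x + b * \<rho> \<nu> x) \<in> L1" for \<nu>
      by (intro L1_add L1_cmult \<sigma> \<rho>)
    show "a * \<Phi> u v + b * \<Psi> u v = canonical_form m (\<lambda>\<nu> x. a * \<sigma> \<nu> x + b * \<rho> \<nu> x) u v" if "jet_pair m u v" for u v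
      using that by (simp add: canonical_form_lincomb \<sigma> \<rho> \<Phi> \<Psi>)
  qed
qed

lemma canonical_form_single:
  shows "k \<le> m \<Longrightarrow> canonical_form m (\<lambda>\<nu>. if \<nu> = 2 * k then s else (\<lambda>_. 0)) u v = even_form m k s u v"
    and "k < m \<Longrightarrow> canonical_form m (\<lambda>\<nu>. if \<nu> = 2 * k + 1 then s else (\<lambda>_. 0)) u v = odd_form m k s u v"
    and "canonical_form m (\<lambda>_ _. 0) u v = 0"
proof -
  have e0: "even_form m i (\<lambda>_. 0) u v = 0" and o0: "odd_form m i (\<lambda>_. 0) u v = 0" for i
    by (simp_all add: even_form_def odd_form_def)
  show "canonical_form m (\<lambda>_ _. 0) u v = 0"
    by (simp add: canonical_form_def e0 o0)
  have e: "even_form m i (if i = k then s else (\<lambda>_. 0)) u v = (if i = k then even_form m i s u v else 0)"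
    and o: "odd_form m i (if i = k then s else (\<lambda>_. 0)) u v = (if i = k then odd_form m i s u v else 0)" for i
    by (auto simp: e0 o0)
  have odd: "2 * i \<noteq> Suc (2 * k)" "Suc (2 * i) \<noteq> 2 * k" for i k :: nat
    by presburger+
  show "canonical_form m (\<lambda>\<nu>. if \<nu> = 2 * k then s else (\<lambda>_. 0)) u v = even_form m k s u v" if "k \<le> m"
    using that by (simp add: canonical_form_def e o odd sum.delta e0 o0)
  show "canonical_form m (\<lambda>\<nu>. if \<nu> = 2 * k + 1 then s else (\<lambda>_. 0)) u v = odd_form m k s u v" if "k < m"
    using that by (simp add: canonical_form_def e o odd sum.delta e0 o0)
qed

lemma zero_in_L1: "(\<lambda>_. 0) \<in> L1"
  by (simp add: L1_continuous)

lemma representable_even_form: "k \<le> m \<Longrightarrow> s \<in> L1 \<Longrightarrow> representable m (even_form m k s)"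
  unfolding representable_def
  by (intro exI[of _ "\<lambda>\<nu>. if \<nu> = 2 * k then s else (\<lambda>_. 0)"]) (auto simp: canonical_form_single(1) zero_in_L1)

lemma representable_odd_form: "k < m \<Longrightarrow> s \<in> L1 \<Longrightarrow> representable m (odd_form m k s)"
  unfolding representable_def
  by (intro exI[of _ "\<lambda>\<nu>. if \<nu> = 2 * k + 1 then s else (\<lambda>_. 0)"]) (use canonical_form_single(2) zero_in_L1 in auto)

lemma representable_sum:
  assumes "\<And>i. i \<in> I \<Longrightarrow> representable m (\<Phi> i)"
  shows "representable m (\<lambda>u v. \<Sum>i\<in>I. a i * \<Phi> i u v)"
  using assms
proof (induction I rule: infinite_finite_induct)
  case (insert i I)
  then have "representable m (\<lambda>u v. a i * \<Phi> i u v + 1 * (\<Sum>i\<in>I. a i * \<Phi> i u v))"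
    by (intro representable_lincomb) auto
  then show ?case using insert.hyps by simp
qed (auto simp: representable_def canonical_form_single(3) zero_in_L1 intro!: exI[of _ "\<lambda>_ _. 0"])

section \<open>Raising the level and reducing moments to the canonical form\<close>

lemma has_L1_deriv_primitive: "c \<in> L1 \<Longrightarrow> has_L1_deriv (\<lambda>x. integral {0..x} c) c"
  by (simp add: has_L1_deriv_def)

text \<open>The boundary terms vanish with \<open>v b\<close>, and \<open>a < m\<close> is what
  makes \<open>u a\<close> continuously differentiable. The signs are written as factors
  \<open>(-1)\<close> to fit \<open>representable_lincomb\<close>.\<close>

lemma moment_by_parts:
  assumes uv: "jet_pair m u v" and c: "c \<in> L1" and a: "a < m"
  defines "C \<equiv> \<lambda>x. integral {0..x} c"
  shows "moment a b c u v = (-1) * moment (Suc a) b C u v + (-1) * moment a (Suc b) C u v"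
proof -
  have C: "C \<in> L1"
    unfolding C_def by (intro L1_continuous L1_integral_continuous c)
  have contu: "continuous_on {0..1} (u a)" "continuous_on {0..1} (u (Suc a))"
    using a by (auto intro!: jet_pair_continuous[OF uv])
  note contv = jet_pair_continuous(2)[OF uv]
  have "moment a b c u v = - integral {0..1} (\<lambda>x. C x * (u a x * v (Suc b) x + u (Suc a) x * v b x))"
    unfolding moment_def C_def
  proof (rule integral_by_parts_L1[OF has_L1_deriv_primitive[OF c]])
    show "((\<lambda>x. u a x * v b x) has_vector_derivative u a x * v (Suc b) x + u (Suc a) x * v b x) (at x within {0..1})"
      if "x \<in> {0..1}" for x
      using uv a that by (intro has_vector_derivative_mult) (auto simp: jet_pair_def)
    show "continuous_on {0..1} (\<lambda>x. u a x * v (Suc b) x + u (Suc a) x * v b x)"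
      by (intro continuous_intros contu contv)
  qed (use uv in \<open>auto simp: jet_pair_def\<close>)
  also have "integral {0..1} (\<lambda>x. C x * (u a x * v (Suc b) x + u (Suc a) x * v b x))
      = moment a (Suc b) C u v + moment (Suc a) b C u v"
    unfolding moment_def distrib_left
    by (intro integral_add L1_integrable L1_mult_continuous continuous_intros C contu contv)
  finally show ?thesis by simp
qed

text \<open>The induction is on the distance \<open>2 * m - (a + b)\<close> from the top level.
  Integration by parts lowers it by one, and the primitive that replaces \<open>c\<close> is again
  integrable, so the hypothesis applies to both new moments.\<close>

lemma representable_moment:
  assumes "a \<le> m" "b \<le> m" "c \<in> L1"
  shows "representable m (moment a b c)"
  using assms
proof (induction "2 * m - (a + b)" arbitrary: a b c rule: less_induct)
  case less
  \<comment> \<open>Stated for every interior pair of the level of \<open>(a, b)\<close>, since the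
    Leibniz expansions used for the boundary pairs run through the whole level.\<close>
  have interior: "representable m (moment i j c)" if ij: "i < m" "j < m" "i + j = a + b" for i j
  proof -
    let ?C = "\<lambda>x. integral {0..x} c"
    have C: "?C \<in> L1"
      by (intro L1_continuous L1_integral_continuous less.prems)
    have "representable m (moment (Suc i) j ?C)" "representable m (moment i (Suc j) ?C)"
      using ij less.prems(1,2) by (auto intro!: less.hyps C)
    then have "representable m (\<lambda>u v. (-1) * moment (Suc i) j ?C u v + (-1) * moment i (Suc j) ?C u v)"
      by (rule representable_lincomb)
    then show ?thesis
      by (rule representable_cong) (rule moment_by_parts[OF _ less.prems(3) ij(1)])
  qed
  show ?case
  proof (cases "a < m \<and> b < m")
    case True
    then show ?thesis by (auto intro: interior)
  next
    case False
    show ?thesis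
    proof (cases "a = m \<and> b = m")
      case True
      have "representable m (even_form m m c)"
        by (intro representable_even_form less.prems) simp
      then show ?thesis
        by (rule representable_cong) (use True less.prems even_form_eq_sum in auto)
    next
      case False
      define k where "k = min a b"
      have k: "k < m" "a = m \<and> b = k \<or> a = k \<and> b = m"
        using False \<open>\<not> (a < m \<and> b < m)\<close> less.prems by (auto simp: k_def min_def)
      \<comment> \<open>\<open>N\<close> is the Leibniz order of the odd form on this level; the
        even form has order \<open>Suc N\<close>.\<close>
      define N where "N = m - k - 1"
      have N: "m - k = Suc N" "m = Suc (k + N)" using k by (auto simp: N_def)
      have c: "c \<in> L1" by (rule less.prems)
      have sum: "representable m (\<lambda>u v. moment k m c u v + moment m k c u v)"
      proof -
        have "representable m (\<lambda>u v. \<Sum>j\<in>{1..N}. of_nat (Suc N choose j) * moment (k + j) (m - j) c u v)"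
          using k N by (intro representable_sum interior) auto
        from representable_lincomb[OF representable_even_form[OF less_imp_le[OF k(1)] c] this, of "(-1) ^ Suc N" "-1"]
        show ?thesis
        proof (rule representable_cong)
          fix u v assume uv: "jet_pair m u v"
          have "(\<Sum>j\<le>Suc N. of_nat (Suc N choose j) * moment (k + j) (m - j) c u v)
            = moment k m c u v + (\<Sum>j\<in>{1..N}. of_nat (Suc N choose j) * moment (k + j) (m - j) c u v) + moment m k c u v"
          proof -
            have "{..Suc N} = insert 0 (insert (Suc N) {1..N})" by auto
            then show ?thesis using N by simp
          qed
          then show "moment k m c u v + moment m k c u v = (-1) ^ Suc N * even_form m k c u v
              + (-1) * (\<Sum>j\<in>{1..N}. of_nat (Suc N choose j) * moment (k + j) (m - j) c u v)"
            unfolding even_form_eq_sum[OF uv c less_imp_le[OF k(1)]] N(1)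
            by (simp flip: power_mult_distrib mult.assoc)
        qed
      qed
      have diff: "representable m (\<lambda>u v. moment k m c u v - moment m k c u v)"
      proof -
        have 1: "representable m (\<lambda>u v. \<Sum>j\<in>{1..N}. of_nat (N choose j) * moment (k + j) (m - j) c u v)"
          using k N by (intro representable_sum interior) auto
        \<comment> \<open>The boundary pair sits at the upper end \<open>j = N\<close> of this sum,
          but at the lower end \<open>j = 0\<close> of the previous one; hence the different index
          sets.\<close>
        have 2: "representable m (\<lambda>u v. \<Sum>j\<in>{..<N}. of_nat (N choose j) * moment (Suc k + j) (m - 1 - j) c u v)"
          using k N by (intro representable_sum interior) auto
        from representable_lincomb[OF representable_odd_form[OF k(1) c] representable_lincomb[OF 1 2, of "-1" 1], of "(-1) ^ N" 1]
        show ?thesis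
        proof (rule representable_cong)
          fix u v assume uv: "jet_pair m u v"
          have "(\<Sum>j\<le>N. of_nat (N choose j) * moment (k + j) (m - j) c u v)
            = moment k m c u v + (\<Sum>j\<in>{1..N}. of_nat (N choose j) * moment (k + j) (m - j) c u v)"
          proof -
            have "{..N} = insert 0 {1..N}" by auto
            then show ?thesis by simp
          qed
          moreover have "(\<Sum>j\<le>N. of_nat (N choose j) * moment (Suc k + j) (m - 1 - j) c u v)
            = moment m k c u v + (\<Sum>j\<in>{..<N}. of_nat (N choose j) * moment (Suc k + j) (m - 1 - j) c u v)"
          proof -
            have "{..N} = insert N {..<N}" by auto
            then show ?thesis using N by simp
          qed
          ultimately show "moment k m c u v - moment m k c u v = (-1) ^ N * odd_form m k c u v
              + 1 * ((-1) * (\<Sum>j\<in>{1..N}. of_nat (N choose j) * moment (k + j) (m - j) c u v)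
                + 1 * (\<Sum>j\<in>{..<N}. of_nat (N choose j) * moment (Suc k + j) (m - 1 - j) c u v))"
            unfolding odd_form_eq_sum[OF uv c k(1)] N_def[symmetric]
            by (simp flip: power_mult_distrib mult.assoc)
        qed
      qed
      show ?thesis
      proof (cases "a = m")
        case True
        with k have "b = k" by auto
        from representable_lincomb[OF sum diff, of "1/2" "-1/2"] show ?thesis
          by (rule representable_cong) (simp add: True \<open>b = k\<close> field_simps)
      next
        case False
        with k have "a = k" "b = m" by auto
        from representable_lincomb[OF sum diff, of "1/2" "1/2"] show ?thesis
          by (rule representable_cong) (simp add: \<open>a = k\<close> \<open>b = m\<close> field_simps)
      qed
    qed
  qed
qed

section \<open>Quasi-derivatives\<close>

lemma AE_lebesgue_onE:
  assumes "AE x in lebesgue_on {0..1::real}. P x"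
  obtains N where "negligible N" "\<And>x. x \<in> {0..1} - N \<Longrightarrow> P x"
proof -
  have "AE x in lebesgue. x \<in> {0..1} \<longrightarrow> P x"
    using assms by (simp add: AE_restrict_space_iff)
  then obtain N where "negligible N" "{x. \<not> (x \<in> {0..1} \<longrightarrow> P x)} \<subseteq> N"
    unfolding eventually_ae_filter_negligible by blast
  then show thesis
    by (intro that[of N]) auto
qed

lemma matrix_class_L1:
  assumes "F \<in> matrix_class m" "k \<in> {1..2 * m + 1}" "j \<in> {1..2 * m + 1}"
  shows "F k j \<in> L1"
proof (cases "k < m + 1 \<or> j > m + 1")
  case True
  then have zero: "F k j x = 0" if "x \<in> {0..1}" for x
    using assms that by (auto simp: matrix_class_def)
  have "F k j absolutely_integrable_on {0..1} \<longleftrightarrow> (\<lambda>_::real. 0 :: complex) absolutely_integrable_on {0..1}"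
    by (rule set_integrable_cong) (simp_all add: zero)
  then show ?thesis using zero_in_L1 by (simp add: L1_def)
next
  case False
  then show ?thesis using assms by (auto simp: matrix_class_def)
qed

lemma quasi_derivs_continuous:
  assumes "quasi_derivs m F y q" "k \<le> 2 * m"
  shows "continuous_on {0..1} (q k)"
proof -
  have "Suc k \<in> {1..2 * m + 1}" using assms(2) by auto
  then obtain g where "has_L1_deriv (q (Suc k - 1)) g"
    using assms(1) unfolding quasi_derivs_def by blast
  then show ?thesis by (simp add: has_L1_deriv_continuous)
qed

text \<open>Row \<open>Suc k\<close> of \<open>F\<close> vanishes for \<open>k < m\<close>, so
  \<open>q (Suc k)\<close> is almost everywhere the density of \<open>q k\<close>. It is also
  continuous, having an integrable density of its own, and this turns the almost-everywhere relation
  into a derivative at every point, one-sided at the ends.\<close>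

lemma quasi_derivs_has_vector_derivative:
  assumes F: "F \<in> matrix_class m" and q: "quasi_derivs m F y q" and k: "k < m" and x: "x \<in> {0..1}"
  shows "(q k has_vector_derivative q (Suc k) x) (at x within {0..1})"
proof -
  have "Suc k \<in> {1..2 * m + 1}" using k by auto
  then obtain g where g: "has_L1_deriv (q (Suc k - 1)) g"
    and "AE x in lebesgue_on {0..1}. q (Suc k) x = g x - (\<Sum>j=1..Suc k. F (Suc k) j x * q (j - 1) x)"
    using q unfolding quasi_derivs_def by blast
  then obtain N where N: "negligible N"
    and eq: "\<And>x. x \<in> {0..1} - N \<Longrightarrow> q (Suc k) x = g x - (\<Sum>j=1..Suc k. F (Suc k) j x * q (j - 1) x)"
    by (elim AE_lebesgue_onE) blast
  have "F (Suc k) j x = 0" if "j \<in> {1..Suc k}" "x \<in> {0..1}" for j x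
    using F k that by (auto simp: matrix_class_def)
  then have eq: "q (Suc k) x = g x" if "x \<in> {0..1} - N" for x
    using eq[OF that] that by simp
  have int: "q k t = q k 0 + integral {0..t} (q (Suc k))" if t: "t \<in> {0..1}" for t
  proof -
    have "integral {0..t} (q (Suc k)) = integral {0..t} g"
      using t by (intro integral_spike[OF N]) (auto simp: eq)
    moreover have "q k t = q k 0 + integral {0..t} g"
      using g t unfolding has_L1_deriv_def diff_Suc_1 by blast
    ultimately show ?thesis by simp
  qed
  have "((\<lambda>t. integral {0..t} (q (Suc k))) has_vector_derivative q (Suc k) x) (at x within {0..1})"
    using k by (intro integral_has_vector_derivative quasi_derivs_continuous[OF q] x) auto
  then have "((\<lambda>t. q k 0 + integral {0..t} (q (Suc k))) has_vector_derivative q (Suc k) x) (at x within {0..1})"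
    by (intro has_vector_derivative_add[of "\<lambda>_. q k 0" 0, simplified] has_vector_derivative_const)
  then show ?thesis
    by (rule has_vector_derivative_transform[OF x, rotated]) (rule int)
qed

lemma quasi_derivs_jet_pair:
  assumes "F \<in> matrix_class m" "quasi_derivs m F y q" "z \<in> test_functions"
  shows "jet_pair m q (\<lambda>j. (vderiv ^^ j) z)"
  unfolding jet_pair_def
  by (intro conjI allI ballI impI quasi_derivs_has_vector_derivative[OF assms(1,2)]
      quasi_derivs_continuous[OF assms(2)] test_function_has_vector_derivative[OF assms(3)]
      test_function_eq_0[OF assms(3)]) auto

lemma quasi_derivs_eq_vderiv:
  assumes F: "F \<in> matrix_class m" and q: "quasi_derivs m F y q" and k: "k \<le> m" and x: "x \<in> {0<..<1}"
  shows "(vderiv ^^ k) y x = q k x"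
proof (rule vderiv_funpow_eq[where S = "{0<..<1}" and n = m])
  show "y x = q 0 x" if "x \<in> {0<..<1}" for x
    using q that by (simp add: quasi_derivs_def)
  fix j and t :: real assume j: "j < m" and t: "t \<in> {0<..<1}"
  then have "(q j has_vector_derivative q (Suc j) t) (at t within {0<..<1})"
    by (intro has_vector_derivative_within_subset[OF quasi_derivs_has_vector_derivative[OF F q]]) auto
  then show "(q j has_vector_derivative q (Suc j) t) (at t)"
    using at_within_open[of t "{0<..<1}"] t by simp
qed (use k x in auto)

text \<open>Unfolding one quasi-derivative produces a new row of \<open>F\<close> and moves one
  derivative to the test function, so \<open>s\<close> has to be general in the induction on
  \<open>r\<close>. Row \<open>k\<close> appears after \<open>r - k\<close> such moves, which
  explains its sign and the order \<open>s + r - k\<close>.\<close>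

lemma integral_quasi_deriv:
  assumes F: "F \<in> matrix_class m" and q: "quasi_derivs m F y q" and z: "z \<in> test_functions"
    and r: "r \<le> 2 * m + 1"
  defines "v \<equiv> \<lambda>j. (vderiv ^^ j) z"
  shows "integral {0..1} (\<lambda>x. q r x * v s x) = (-1) ^ r * integral {0..1} (\<lambda>x. q 0 x * v (s + r) x)
    - (\<Sum>k=1..r. \<Sum>j=1..k. (-1) ^ (r - k) * moment (j - 1) (s + r - k) (F k j) q v)"
  using r
proof (induction r arbitrary: s)
  case 0
  then show ?case by simp
next
  case (Suc r)
  have contv: "continuous_on {0..1} (v k)" for k
    unfolding v_def by (rule test_function_continuous[OF z])
  note contq = quasi_derivs_continuous[OF q]
  have "Suc r \<in> {1..2 * m + 1}" using Suc.prems by auto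
  then obtain g where g: "has_L1_deriv (q (Suc r - 1)) g"
    and "AE x in lebesgue_on {0..1}. q (Suc r) x = g x - (\<Sum>j=1..Suc r. F (Suc r) j x * q (j - 1) x)"
    using q unfolding quasi_derivs_def by blast
  then obtain N where N: "negligible N"
    and eq: "\<And>x. x \<in> {0..1} - N \<Longrightarrow> q (Suc r) x = g x - (\<Sum>j=1..Suc r. F (Suc r) j x * q (j - 1) x)"
    by (elim AE_lebesgue_onE) blast
  have FL: "F (Suc r) j \<in> L1" if "j \<in> {1..Suc r}" for j
    using Suc.prems that by (intro matrix_class_L1[OF F]) auto
  have gL: "g \<in> L1" using g by (simp add: has_L1_deriv_def)
  have mL: "(\<lambda>x. F (Suc r) j x * (q (j - 1) x * v s x)) integrable_on {0..1}" if "j \<in> {1..Suc r}" for j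
    using that Suc.prems by (intro L1_integrable L1_mult_continuous FL continuous_intros contq contv) auto
  have "integral {0..1} (\<lambda>x. q (Suc r) x * v s x)
      = integral {0..1} (\<lambda>x. g x * v s x - (\<Sum>j=1..Suc r. F (Suc r) j x * (q (j - 1) x * v s x)))"
  proof (rule integral_spike[OF N])
    fix x assume "x \<in> {0..1} - N"
    from eq[OF this] show "g x * v s x - (\<Sum>j=1..Suc r. F (Suc r) j x * (q (j - 1) x * v s x)) = q (Suc r) x * v s x"
      by (simp only: left_diff_distrib sum_distrib_right mult.assoc)
  qed
  also have "\<dots> = integral {0..1} (\<lambda>x. g x * v s x)
      - integral {0..1} (\<lambda>x. \<Sum>j=1..Suc r. F (Suc r) j x * (q (j - 1) x * v s x))"
    by (intro integral_diff integrable_sum L1_integrable[OF L1_mult_continuous[OF gL contv]] mL) auto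
  also have "integral {0..1} (\<lambda>x. \<Sum>j=1..Suc r. F (Suc r) j x * (q (j - 1) x * v s x))
      = (\<Sum>j=1..Suc r. moment (j - 1) s (F (Suc r) j) q v)"
    unfolding moment_def by (intro integral_sum mL) auto
  \<comment> \<open>Here \<open>q r\<close> is merely absolutely continuous, with density
    \<open>g\<close>; all smoothness comes from \<open>v\<close>.\<close>
  also have "integral {0..1} (\<lambda>x. g x * v s x) = - integral {0..1} (\<lambda>x. q r x * v (Suc s) x)"
  proof (rule integral_by_parts_L1)
    show "has_L1_deriv (q r) g" using g by simp
    show "(v s has_vector_derivative v (Suc s) x) (at x within {0..1})" for x
      unfolding v_def by (rule test_function_has_vector_derivative[OF z])
  qed (auto simp: v_def intro!: contv[unfolded v_def] test_function_eq_0[OF z] simp del: funpow.simps)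
  also have "integral {0..1} (\<lambda>x. q r x * v (Suc s) x) = (-1) ^ r * integral {0..1} (\<lambda>x. q 0 x * v (Suc s + r) x)
      - (\<Sum>k=1..r. \<Sum>j=1..k. (-1) ^ (r - k) * moment (j - 1) (Suc s + r - k) (F k j) q v)"
    using Suc.prems by (intro Suc.IH) simp
  finally have *: "integral {0..1} (\<lambda>x. q (Suc r) x * v s x)
      = - ((-1) ^ r * integral {0..1} (\<lambda>x. q 0 x * v (Suc s + r) x)
        - (\<Sum>k=1..r. \<Sum>j=1..k. (-1) ^ (r - k) * moment (j - 1) (Suc s + r - k) (F k j) q v))
        - (\<Sum>j=1..Suc r. moment (j - 1) s (F (Suc r) j) q v)" .
  have "(\<Sum>k=1..r. \<Sum>j=1..k. (-1) ^ (Suc r - k) * moment (j - 1) (s + Suc r - k) (F k j) q v)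
      = - (\<Sum>k=1..r. \<Sum>j=1..k. (-1) ^ (r - k) * moment (j - 1) (Suc s + r - k) (F k j) q v)"
    unfolding sum_negf[symmetric] by (intro sum.cong) (auto simp: Suc_diff_le)
  then show ?case
    unfolding * by (simp add: sum.cl_ivl_Suc)
qed

text \<open>The triangle \<open>j \<le> k\<close> of the general formula shrinks to the block where
  \<open>F\<close> may be nonzero; the block lies in the triangle because
  \<open>j \<le> m + 1 \<le> k\<close>. Its shape says exactly that both orders \<open>j - 1\<close>
  and \<open>2 * m + 1 - k\<close> are at most \<open>m\<close>, as
  \<open>representable_moment\<close> demands.\<close>

lemma integral_last_quasi_deriv:
  assumes F: "F \<in> matrix_class m" and q: "quasi_derivs m F y q" and z: "z \<in> test_functions"
  defines "v \<equiv> \<lambda>j. (vderiv ^^ j) z"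
  shows "integral {0..1} (\<lambda>x. q (2 * m + 1) x * z x) = - integral {0..1} (\<lambda>x. q 0 x * v (2 * m + 1) x)
    + (\<Sum>(k, j)\<in>{m + 1..2 * m + 1} \<times> {1..m + 1}.
         - ((-1) ^ (2 * m + 1 - k)) * moment (j - 1) (2 * m + 1 - k) (F k j) q v)"
proof -
  have zero: "moment (j - 1) i (F k j) q v = 0"
    if "k \<in> {1..2 * m + 1}" "j \<in> {1..k}" "k < m + 1 \<or> j > m + 1" for k j i
  proof -
    have 0: "F k j x = 0" if "x \<in> {0..1}" for x
      using F \<open>k \<in> _\<close> \<open>j \<in> _\<close> \<open>_ \<or> _\<close> that by (auto simp: matrix_class_def)
    have "integral {0..1} (\<lambda>x. F k j x * (q (j - 1) x * v i x)) = integral {0..1} (\<lambda>_::real. 0)"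
      by (rule integral_cong) (simp add: 0)
    then show ?thesis by (simp add: moment_def)
  qed
  have outside: "(case p of (k, j) \<Rightarrow> (-1) ^ (2 * m + 1 - k) * moment (j - 1) (2 * m + 1 - k) (F k j) q v) = 0"
    if "p \<in> Sigma {1..2 * m + 1} (\<lambda>k. {1..k}) - {m + 1..2 * m + 1} \<times> {1..m + 1}" for p
  proof -
    obtain k j where p: "p = (k, j)" by fastforce
    have "moment (j - 1) (2 * m + 1 - k) (F k j) q v = 0"
      using that p by (intro zero) auto
    then show ?thesis by (simp add: p)
  qed
  have "(\<Sum>k=1..2 * m + 1. \<Sum>j=1..k. (-1) ^ (2 * m + 1 - k) * moment (j - 1) (2 * m + 1 - k) (F k j) q v)
      = (\<Sum>(k, j)\<in>Sigma {1..2 * m + 1} (\<lambda>k. {1..k}). (-1) ^ (2 * m + 1 - k) * moment (j - 1) (2 * m + 1 - k) (F k j) q v)"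
    by (rule sum.Sigma) auto
  also have "\<dots> = (\<Sum>(k, j)\<in>{m + 1..2 * m + 1} \<times> {1..m + 1}. (-1) ^ (2 * m + 1 - k) * moment (j - 1) (2 * m + 1 - k) (F k j) q v)"
    by (rule sum.mono_neutral_right[OF _ _ ballI[OF outside]]) auto
  finally show ?thesis
    using integral_quasi_deriv[OF F q z order_refl, of 0]
    by (simp add: v_def sum_negf case_prod_unfold)
qed

section \<open>Coefficients of the differential expression\<close>

lemma sing_order_even: "sing_order m (2 * k) = m - k"
  and sing_order_odd: "sing_order m (2 * k + 1) = m - k - 1"
  by (simp_all add: sing_order_def)

context
  fixes m F y q z \<sigma> \<tau>
  assumes F: "F \<in> matrix_class m" and q: "quasi_derivs m F y q" and z: "z \<in> test_functions"
    and \<sigma>: "\<And>\<nu>. \<sigma> \<nu> \<in> L1" and \<tau>: "\<And>\<nu>. \<tau> \<nu> = (dderiv ^^ sing_order m \<nu>) (regular (\<sigma> \<nu>))"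
begin

text \<open>The product differentiates its factor, the \<open>a\<close>-th derivative of
  \<open>y\<close>, another \<open>sing_order m \<nu>\<close> times. The bound keeps the total order
  within the range where quasi-derivatives are classical derivatives.\<close>

lemma dist_mult_quasi_deriv:
  assumes i: "a + sing_order m \<nu> \<le> m"
  shows "(dderiv ^^ b) (dist_mult (sing_order m \<nu>) (\<tau> \<nu>) ((vderiv ^^ a) y)) z
    = (-1) ^ b * ((-1) ^ sing_order m \<nu> * integral {0..1}
        (\<lambda>x. \<sigma> \<nu> x * leibniz (sing_order m \<nu>) (\<lambda>j. q (a + j) x) (\<lambda>j. (vderiv ^^ (b + j)) z x)))"
proof -
  have "dist_mult (sing_order m \<nu>) (\<tau> \<nu>) ((vderiv ^^ a) y) ((vderiv ^^ b) z)
    = (-1) ^ sing_order m \<nu> * integral {0..1}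
        (\<lambda>x. \<sigma> \<nu> x * leibniz (sing_order m \<nu>) (\<lambda>j. q (a + j) x) (\<lambda>j. (vderiv ^^ j) ((vderiv ^^ b) z) x))"
  proof (rule dist_mult_eq[where u = "\<lambda>j. q (a + j)", OF \<sigma>])
    show "dist_eq (\<tau> \<nu>) ((dderiv ^^ sing_order m \<nu>) (regular (\<sigma> \<nu>)))"
      by (simp add: \<tau> dist_eq_def)
    show "(vderiv ^^ b) z \<in> test_functions" by (rule test_function_vderiv[OF z])
    show "(vderiv ^^ a) y x = q (a + 0) x" if "x \<in> {0<..<1}" for x
      using quasi_derivs_eq_vderiv[OF F q _ that, of a] i by simp
    show "(q (a + j) has_vector_derivative q (a + Suc j) x) (at x within {0..1})"
      if "j < sing_order m \<nu>" "x \<in> {0..1}" for j x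
      using quasi_derivs_has_vector_derivative[OF F q, of "a + j"] i that by simp
    show "continuous_on {0..1} (q (a + sing_order m \<nu>))"
      using i by (intro quasi_derivs_continuous[OF q]) simp
  qed
  then show ?thesis
    by (simp add: dderiv_funpow funpow_add add.commute[of b])
qed

lemma ell_eq_canonical_form:
  "ell m \<tau> y z = - integral {0..1} (\<lambda>x. q 0 x * (vderiv ^^ (2 * m + 1)) z x)
    + canonical_form m \<sigma> q (\<lambda>j. (vderiv ^^ j) z)"
proof -
  have sign: "(-1 :: complex) ^ k * ((-1) ^ k * a) = a" "(-1 :: complex) ^ (k + 1) * ((-1) ^ k * a) = - a" for k a
    by (simp_all flip: power_mult_distrib mult.assoc)
  have "(dderiv ^^ (2 * m + 1)) (regular y) z = - integral {0..1} (\<lambda>x. q 0 x * (vderiv ^^ (2 * m + 1)) z x)"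
  proof -
    have "integral {0..1} (\<lambda>x. y x * (vderiv ^^ (2 * m + 1)) z x) = integral {0..1} (\<lambda>x. q 0 x * (vderiv ^^ (2 * m + 1)) z x)"
      using q by (intro integral_cong) (simp add: quasi_derivs_def)
    then show ?thesis by (simp add: dderiv_funpow regular_def del: funpow.simps)
  qed
  moreover have "(-1) ^ k * (dderiv ^^ k) (dist_mult (sing_order m (2 * k)) (\<tau> (2 * k)) ((vderiv ^^ k) y)) z
      = even_form m k (\<sigma> (2 * k)) q (\<lambda>j. (vderiv ^^ j) z)" if "k \<le> m" for k
  proof -
    have "k + sing_order m (2 * k) \<le> m" using that by (simp add: sing_order_even)
    from dist_mult_quasi_deriv[OF this] show ?thesis
      by (simp only: sign even_form_def sing_order_even)
  qed
  moreover have "(-1) ^ (k + 1) *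
      ((dderiv ^^ (k + 1)) (dist_mult (sing_order m (2 * k + 1)) (\<tau> (2 * k + 1)) ((vderiv ^^ k) y)) z
       + (dderiv ^^ k) (dist_mult (sing_order m (2 * k + 1)) (\<tau> (2 * k + 1)) ((vderiv ^^ (k + 1)) y)) z)
      = odd_form m k (\<sigma> (2 * k + 1)) q (\<lambda>j. (vderiv ^^ j) z)" if "k < m" for k
  proof -
    \<comment> \<open>The second bound is an equality: the lower singularity order at odd indices
      pays for the extra derivative on \<open>y\<close>.\<close>
    have le: "k + sing_order m (2 * k + 1) \<le> m" "k + 1 + sing_order m (2 * k + 1) \<le> m"
      using that by (simp_all only: sing_order_odd)
    show ?thesis
      unfolding distrib_left dist_mult_quasi_deriv[OF le(1)] dist_mult_quasi_deriv[OF le(2)]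
      by (simp only: sign odd_form_def sing_order_odd Suc_eq_plus1 right_diff_distrib
          add_uminus_conv_diff)
  qed
  ultimately show ?thesis
    by (simp only: ell_def Let_def canonical_form_def) (simp add: add.assoc del: funpow.simps)
qed

end

text \<open>Both sides of the claimed identity contain the same leading term, the pairing of
  \<open>y\<close> with the derivative of \<open>z\<close> of order \<open>2 * m + 1\<close>. What
  remains is the functional \<open>?\<Phi>\<close>, which is built from \<open>F\<close> alone; the
  family \<open>\<sigma>\<close> is therefore fixed before \<open>y\<close> and \<open>z\<close>
  enter.\<close>

lemma ex_associated_coefficients:
  assumes F: "F \<in> matrix_class m"
  shows "\<exists>\<tau>\<in>coeff_space m. associated m \<tau> F"
proof -
  let ?I = "{m + 1..2 * m + 1} \<times> {1..m + 1}"
  let ?\<Phi> = "\<lambda>u v. \<Sum>p\<in>?I. - ((-1) ^ (2 * m + 1 - fst p)) * moment (snd p - 1) (2 * m + 1 - fst p) (F (fst p) (snd p)) u v"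
  have "representable m ?\<Phi>"
  proof (rule representable_sum)
    fix p assume "p \<in> ?I"
    then show "representable m (moment (snd p - 1) (2 * m + 1 - fst p) (F (fst p) (snd p)))"
      using F by (intro representable_moment) (auto simp: matrix_class_def)
  qed
  then obtain \<sigma> where \<sigma>: "\<And>\<nu>. \<sigma> \<nu> \<in> L1" and rep: "\<And>u v. jet_pair m u v \<Longrightarrow> ?\<Phi> u v = canonical_form m \<sigma> u v"
    unfolding representable_def by blast
  define \<tau> where "\<tau> = (\<lambda>\<nu>. (dderiv ^^ sing_order m \<nu>) (regular (\<sigma> \<nu>)))"
  show ?thesis
  proof (rule bexI)
    show "\<tau> \<in> coeff_space m"
      using dderiv_regular_in_W_neg[OF \<sigma>] by (simp add: coeff_space_def \<tau>_def)
    show "associated m \<tau> F"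
      unfolding associated_def dist_eq_def
    proof (intro ballI allI impI)
      fix y q z assume q: "quasi_derivs m F y q" and z: "z \<in> test_functions"
      have "ell m \<tau> y z = - integral {0..1} (\<lambda>x. q 0 x * (vderiv ^^ (2 * m + 1)) z x)
          + canonical_form m \<sigma> q (\<lambda>j. (vderiv ^^ j) z)"
        by (rule ell_eq_canonical_form[OF F q z \<sigma>]) (simp add: \<tau>_def)
      also have "\<dots> = integral {0..1} (\<lambda>x. q (2 * m + 1) x * z x)"
        unfolding integral_last_quasi_deriv[OF F q z] rep[OF quasi_derivs_jet_pair[OF F q z], symmetric]
        by (simp only: case_prod_unfold)
      finally show "ell m \<tau> y z = regular (q (2 * m + 1)) z"
        by (simp add: regular_def)
    qed
  qed
qed

text \<open>The first conjunct gives the inclusion of \<open>matrix_class m\<close> in the union;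
  the converse is built into \<open>associated_matrices\<close>, which collects only members of
  \<open>matrix_class m\<close>.\<close>

theorem mainTheorem2:
  fixes m :: nat
  shows "(\<forall>F\<in>matrix_class m. \<exists>\<tau>\<in>coeff_space m. associated m \<tau> F) \<and>
         matrix_class m = (\<Union>\<tau>\<in>coeff_space m. associated_matrices m \<tau>)"
  using ex_associated_coefficients by (fastforce simp: associated_matrices_def)

end
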